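(* Let $(A_1,\ldots,A_d)$, $d\ge 2$, be a regular SDC family of real symmetric $n\times n$ matrices, and let $\tilde A_k=A_k+\epsilon E_k$ for $k=1,\ldots,d$, where $\epsilon>0$ and $E_1,\ldots,E_d\in\mathbb{R}^{n\times n}$ satisfy $\|E_1\|_F^2+\cdots+\|E_d\|_F^2=1$. Let $m$ be the number of distinct eigenvalue vectors of the family $(A_1,\ldots,A_d)$. Assume that $\theta,\mu\sim\mathcal{N}(0,I_d)$ are independent Gaussian random vectors. Let $\tilde X\in\mathbb{R}^{n\times n}$ be any invertible matrix such that $\tilde X^T\tilde A(\mu)\tilde X$ and $\tilde X^T\tilde A(\theta)\tilde X$ are diagonal. Then, for any $R>0$, $$\mathrm{Prob}\left(\frac{1}{\|\tilde X\|_2^2}\Big(\sum_{k=1}^d\big\|\mathrm{offdiag}(\tilde X^T\tilde A_k\tilde X)\big\|_F^2\Big)^{1/2}\le (R^2+1)\epsilon+\mathcal{O}(\epsilon^2)\right)\ge 1-\sqrt{\frac{10}{\pi}}\,\frac{m^{3/2}d^{3/4}}{R}.$$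
   Context: All matrices are real. For $\mu\in\mathbb{R}^d$ and a family $(A_1,\ldots,A_d)$, $A(\mu):=\mu_1A_1+\cdots+\mu_dA_d$, and likewise $\tilde A(\mu):=\mu_1\tilde A_1+\cdots+\mu_d\tilde A_d$. A family of symmetric matrices is SDC if there is an invertible $X\in\mathbb{R}^{n\times n}$ such that every $X^TA_kX$ is diagonal. A family is regular if the polynomial $\mu\mapsto\det(A(\mu))$ does not vanish identically. $\mathrm{offdiag}(M)$ is the matrix obtained from $M$ by setting its diagonal entries to zero; $\|\cdot\|_F$ is the Frobenius norm and $\|\cdot\|_2$ the spectral norm. Definition of $m$: choose an invertible $X$ such that $D_k:=X^TA_kX$ is diagonal for all $k$, and $\theta_0\in\mathbb{R}^d$ such that $A(\theta_0)$ is invertible. Put $D(\theta_0)=\sum_k(\theta_0)_kD_k$ (which is invertible) and $\Lambda_k:=D_kD(\theta_0)^{-1}$. Then $m$ is the number of distinct vectors among $[\Lambda_1(i,i),\ldots,\Lambda_d(i,i)]\in\mathbb{R}^d$, $i=1,\ldots,n$; this number does not depend on the choice of $\theta_0$. The term $\mathcal{O}(\epsilon^2)$ is understood asymptotically as $\epsilon\to 0$ (for sufficiently small $\epsilon$); its constant may depend on the matrices $A_k$, $E_k$ and on $\theta,\mu$, but not on $\epsilon$ or $\tilde X$. *)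

theory Defs
  imports "HOL-Probability.Probability"
begin

definition lin_comb :: "('d::finite \<Rightarrow> real^'n^'n) \<Rightarrow> real^'d \<Rightarrow> real^'n^'n" where
  "lin_comb A \<mu> = (\<Sum>k\<in>UNIV. (\<mu> $ k) *\<^sub>R A k)"

definition is_diagonal :: "real^'n^'n \<Rightarrow> bool" where
  "is_diagonal M \<longleftrightarrow> (\<forall>i j. i \<noteq> j \<longrightarrow> M $ i $ j = 0)"

definition offdiag :: "real^'n^'n \<Rightarrow> real^'n^'n" where
  "offdiag M = (\<chi> i j. if i = j then 0 else M $ i $ j)"

definition congr :: "real^'n^'n \<Rightarrow> real^'n^'n \<Rightarrow> real^'n^'n" where
  "congr X M = transpose X ** M ** X"

text \<open>The library norm on matrices is the Frobenius norm, see \<open>frob_norm_eq\<close>.\<close>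

abbreviation frob_norm :: "real^'n^'n \<Rightarrow> real" where
  "frob_norm M \<equiv> norm M"

lemma frob_norm_eq:
  fixes M :: "real^'n^'n"
  shows "frob_norm M = sqrt (\<Sum>i\<in>UNIV. \<Sum>j\<in>UNIV. (M $ i $ j)\<^sup>2)"
  by (simp add: norm_vec_def L2_set_def sum_nonneg)

abbreviation spectral_norm :: "real^'n^'n \<Rightarrow> real" where
  "spectral_norm M \<equiv> onorm ((*v) M)"

definition diagonalizes :: "real^'n^'n \<Rightarrow> ('d::finite \<Rightarrow> real^'n^'n) \<Rightarrow> bool" where
  "diagonalizes X A \<longleftrightarrow> invertible X \<and> (\<forall>k. is_diagonal (congr X (A k)))"

definition SDC :: "('d::finite \<Rightarrow> real^'n^'n) \<Rightarrow> bool" where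
  "SDC A \<longleftrightarrow> (\<exists>X. diagonalizes X A)"

definition regular_family :: "('d::finite \<Rightarrow> real^'n^'n) \<Rightarrow> bool" where
  "regular_family A \<longleftrightarrow> \<not> (\<forall>\<mu>. det (lin_comb A \<mu>) = 0)"

text \<open>With \<open>D\<^sub>k = X\<^sup>T A\<^sub>k X\<close> and \<open>\<Lambda>\<^sub>k = D\<^sub>k D(\<theta>\<^sub>0)\<inverse>\<close>, the vectors
  \<open>[\<Lambda>\<^sub>1(i,i), \<dots>, \<Lambda>\<^sub>d(i,i)]\<close> for all \<open>i\<close>.\<close>

definition eigenvalue_vectors ::
    "('d::finite \<Rightarrow> real^'n^'n) \<Rightarrow> real^'n^'n \<Rightarrow> real^'d \<Rightarrow> (real^'d) set" where
  "eigenvalue_vectors A X \<theta>\<^sub>0 =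
     (let D = (\<lambda>k. congr X (A k));
          \<Lambda> = (\<lambda>k. D k ** matrix_inv (lin_comb D \<theta>\<^sub>0))
      in range (\<lambda>i. \<chi> k. \<Lambda> k $ i $ i))"

text \<open>The number of distinct eigenvalue vectors, as a relation: it may be computed from any
  admissible choice of \<open>X\<close> and \<open>\<theta>\<^sub>0\<close>, so a statement assuming this relation covers every choice.\<close>

definition num_eigenvalue_vectors :: "('d::finite \<Rightarrow> real^'n^'n) \<Rightarrow> nat \<Rightarrow> bool" where
  "num_eigenvalue_vectors A m \<longleftrightarrow>
     (\<exists>X \<theta>\<^sub>0. diagonalizes X A \<and> invertible (lin_comb A \<theta>\<^sub>0) \<and>
             m = card (eigenvalue_vectors A X \<theta>\<^sub>0))"

text \<open>The Lebesgue density of \<open>\<N>(0, I\<^sub>d)\<close>.\<close>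

definition std_gaussian_density :: "real^'d::finite \<Rightarrow> real" where
  "std_gaussian_density x = (\<Prod>k\<in>UNIV. std_normal_density (x $ k))"

definition perturb ::
    "('d::finite \<Rightarrow> real^'n^'n) \<Rightarrow> ('d \<Rightarrow> real^'n^'n) \<Rightarrow> real \<Rightarrow> 'd \<Rightarrow> real^'n^'n" where
  "perturb A E \<epsilon> k = A k + \<epsilon> *\<^sub>R E k"

definition offdiag_error :: "('d::finite \<Rightarrow> real^'n^'n) \<Rightarrow> real^'n^'n \<Rightarrow> real" where
  "offdiag_error A X =
     1 / (spectral_norm X)\<^sup>2 * sqrt (\<Sum>k\<in>UNIV. (frob_norm (offdiag (congr X (A k))))\<^sup>2)"

text \<open>The error bound with leading coefficient \<open>c\<close> for fixed vectors \<open>\<theta>\<close> and \<open>\<mu>\<close>. The constant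
  \<open>C\<close> of the second order term depends neither on \<open>\<epsilon>\<close> nor on the matrix \<open>X\<close>, and the latter is
  arbitrary, so it may depend on \<open>\<epsilon>\<close>, \<open>\<theta>\<close> and \<open>\<mu>\<close>.\<close>

definition first_order_bound ::
    "('d::finite \<Rightarrow> real^'n^'n) \<Rightarrow> ('d \<Rightarrow> real^'n^'n) \<Rightarrow> real \<Rightarrow> real^'d \<Rightarrow> real^'d \<Rightarrow> bool" where
  "first_order_bound A E c \<theta> \<mu> \<longleftrightarrow>
     (\<exists>C. \<forall>\<^sub>F \<epsilon> in at_right 0. \<forall>X.
        invertible X \<longrightarrow>
        is_diagonal (congr X (lin_comb (perturb A E \<epsilon>) \<mu>)) \<longrightarrow>
        is_diagonal (congr X (lin_comb (perturb A E \<epsilon>) \<theta>)) \<longrightarrow>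
        offdiag_error (perturb A E \<epsilon>) X \<le> c * \<epsilon> + C * \<epsilon>\<^sup>2)"

end

theory Submission
  imports Defs
begin

text \<open>The idea is to separate a deterministic perturbation bound from an estimate for Gaussian vectors.

In coordinates that diagonalize the whole family, every \<open>A\<^sub>k\<close> is a weighted sum of squares, and the
weight of the \<open>l\<close>-th square is \<open>\<delta>\<^sub>l\<close> times the \<open>k\<close>-th entry of the eigenvalue vector \<open>\<Lambda>\<^sub>l\<close>
(\<open>eigenvalue_vectors_decomposition\<close>). A column \<open>x\<^sub>i\<close> of the approximate diagonalizer is annihilated by
a normalized linear combination of the two perturbed matrices, so its coordinates are \<open>O(\<epsilon>)\<close> except
at the indices of a single eigenvalue vector \<open>\<gamma> i\<close> (\<open>eigenvector_localization\<close>). Hence for \<open>i \<noteq> j\<close> the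
vector \<open>q = (x\<^sub>i\<^sup>T A\<^sub>k x\<^sub>j)\<^sub>k\<close> of \<open>\<real>\<^sup>d\<close> lies, up to \<open>O(\<epsilon>\<^sup>2)\<close>, in the span of \<open>\<gamma> i\<close> and \<open>\<gamma> j\<close>. With
\<open>e = (x\<^sub>i\<^sup>T E\<^sub>k x\<^sub>j)\<^sub>k\<close>, the off-diagonal entries of the perturbed family form the vector \<open>q + \<epsilon> e\<close>, and it
is orthogonal to \<open>\<theta>\<close> and \<open>\<mu>\<close>. If \<open>\<Phi>\<close> is the projection onto that span along the complement of
\<open>\<theta>\<close> and \<open>\<mu>\<close>, then \<open>q + \<epsilon> e = (I - \<Phi>) (\<epsilon> e) + O(\<epsilon>\<^sup>2)\<close> (\<open>well_conditioned_error\<close>). A bound \<open>R\<^sup>2\<close> on the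
norms of all these projections gives the factor \<open>R\<^sup>2 + 1\<close>; summing over \<open>i\<close>, \<open>j\<close> and using that
congruence by \<open>X\<close> enlarges Frobenius norms at most by the square of the spectral norm of \<open>X\<close> yields
the error bound (\<open>first_order_bound_well_conditioned\<close>).

It remains to show that the projections are rarely large. The projection onto the span of \<open>g\<close> and \<open>h\<close>
is \<open>a \<theta>\<^sup>T + b \<mu>\<^sup>T\<close>, where \<open>a\<close> is the unit vector of the span orthogonal to \<open>\<mu>\<close>, divided by its
inner product with \<open>\<theta>\<close>, and symmetrically for \<open>b\<close>. As \<open>\<mu>\<close> is independent of \<open>\<theta>\<close>, that inner product
is standard normal, so it is at most \<open>\<tau>\<close> in absolute value with probability at most \<open>sqrt (2 / pi) * \<tau>\<close>
(\<open>std_gaussian_random_direction_small_ball\<close>). A union bound over the pairs of eigenvalue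
vectors, a Markov bound for the norms of \<open>\<theta>\<close> and \<open>\<mu>\<close>, and a suitable threshold for those norms then
give the stated probability.\<close>

section \<open>Matrix norms and congruence\<close>

lemma matrix_inv:
  fixes X :: "real^'n^'n"
  assumes "invertible X"
  shows matrix_mult_matrix_inv: "X ** matrix_inv X = mat 1"
    and matrix_inv_matrix_mult: "matrix_inv X ** X = mat 1"
  using someI_ex[OF assms[unfolded invertible_def]] unfolding matrix_inv_def by auto

lemma power2_norm_matrix:
  fixes M :: "real^'n^'n"
  shows "(norm M)\<^sup>2 = (\<Sum>i\<in>UNIV. \<Sum>j\<in>UNIV. (M $ i $ j)\<^sup>2)"
  by (simp add: frob_norm_eq sum_nonneg)

lemma norm_transpose_matrix:
  fixes M :: "real^'n^'n"
  shows "norm (transpose M) = norm M"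
  by (simp add: frob_norm_eq transpose_def) (subst sum.swap, rule refl)

lemma norm_matrix_vector_le: "norm (M *v x) \<le> spectral_norm M * norm x"
  for M :: "real^'n^'n"
  by (rule onorm) (rule matrix_vector_mul_bounded_linear)

lemma spectral_norm_nonneg: "0 \<le> spectral_norm M"
  for M :: "real^'n^'n"
  by (rule onorm_pos_le) (rule matrix_vector_mul_bounded_linear)

text \<open>A matrix and its transpose have the same spectral norm: the squared norm of \<open>x\<^sup>T M\<close> is the
  inner product of \<open>x\<close> with \<open>M (x\<^sup>T M)\<close>.\<close>

lemma norm_vector_matrix_le:
  fixes M :: "real^'n^'n"
  shows "norm (x v* M) \<le> spectral_norm M * norm x"
proof (cases "x v* M = 0")
  case True
  then show ?thesis by (simp add: spectral_norm_nonneg)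
next
  case False
  have "norm (x v* M) * norm (x v* M) = x \<bullet> (M *v (x v* M))"
    unfolding dot_lmul_matrix[symmetric] by (simp add: dot_square_norm power2_eq_square)
  also have "\<dots> \<le> norm x * norm (M *v (x v* M))"
    by (rule norm_cauchy_schwarz)
  also have "\<dots> \<le> norm x * (spectral_norm M * norm (x v* M))"
    by (intro mult_left_mono norm_matrix_vector_le) simp
  finally show ?thesis
    using False by (simp add: mult.commute mult.left_commute)
qed

lemma norm_matrix_mult_right_le:
  fixes M X :: "real^'n^'n"
  shows "norm (M ** X) \<le> spectral_norm X * norm M"
proof (rule power2_le_imp_le)
  have row: "(M ** X) $ i = (M $ i) v* X" for i
    by (simp add: vec_eq_iff matrix_matrix_mult_def vector_matrix_mult_def mult.commute)
  have sq: "(norm N)\<^sup>2 = (\<Sum>i\<in>UNIV. (norm (N $ i))\<^sup>2)" for N :: "real^'n^'n"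
    by (simp add: norm_vec_def L2_set_def sum_nonneg)
  have "(norm (M ** X))\<^sup>2 \<le> (\<Sum>i\<in>UNIV. (spectral_norm X * norm (M $ i))\<^sup>2)"
    unfolding sq row by (intro sum_mono power_mono norm_vector_matrix_le) simp
  also have "\<dots> = (spectral_norm X * norm M)\<^sup>2"
    by (simp add: power_mult_distrib sq sum_distrib_left)
  finally show "(norm (M ** X))\<^sup>2 \<le> (spectral_norm X * norm M)\<^sup>2" .
qed (simp add: spectral_norm_nonneg)

text \<open>The Frobenius norm is taken row by row, so one factor is applied to the rows of \<open>M\<close> and the
  other one, after a transposition, to its columns.\<close>

lemma norm_congr_le:
  fixes M X :: "real^'n^'n"
  shows "norm (congr X M) \<le> (spectral_norm X)\<^sup>2 * norm M"
proof -
  have "norm (congr X M) \<le> spectral_norm X * norm (transpose (transpose X ** M))"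
    unfolding congr_def norm_transpose_matrix by (rule norm_matrix_mult_right_le)
  also have "\<dots> \<le> spectral_norm X * (spectral_norm X * norm (transpose M))"
    unfolding matrix_transpose_mul transpose_transpose
    by (intro mult_left_mono norm_matrix_mult_right_le spectral_norm_nonneg)
  finally show ?thesis
    by (simp add: norm_transpose_matrix power2_eq_square mult.assoc)
qed

lemma inner_congr: "z \<bullet> (congr X M *v w) = (X *v z) \<bullet> (M *v (X *v w))"
  for M X :: "real^'n^'n"
  by (simp add: congr_def dot_lmul_matrix flip: matrix_vector_mul_assoc)
     (metis dot_lmul_matrix inner_commute vector_transpose_matrix)

lemma congr_entry: "congr X M $ i $ j = column i X \<bullet> (M *v column j X)"
  for M X :: "real^'n^'n"
  using inner_congr[of "axis i 1" X M "axis j 1"]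
  by (simp add: inner_axis' matrix_vector_mult_basis column_def)

lemma inner_lin_comb:
  fixes A :: "'d::finite \<Rightarrow> real^'n^'n"
  shows "x \<bullet> (lin_comb A \<nu> *v y) = \<nu> \<bullet> (\<chi> k. x \<bullet> (A k *v y))"
proof -
  have lin: "linear (\<lambda>M :: real^'n^'n. M *v y)"
    by (simp add: linear_iff matrix_vector_mult_add_rdistrib scaleR_matrix_vector_assoc)
  have "lin_comb A \<nu> *v y = (\<Sum>k\<in>UNIV. \<nu> $ k *\<^sub>R (A k *v y))"
    unfolding lin_comb_def linear_sum[OF lin] linear_cmul[OF lin] ..
  then show ?thesis
    by (simp add: inner_sum_right inner_vec_def[of \<nu>])
qed

lemma lin_comb_congr: "lin_comb (\<lambda>k. congr X (A k)) \<nu> = congr X (lin_comb A \<nu>)"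
  for A :: "'d::finite \<Rightarrow> real^'n^'n"
proof -
  have "lin_comb (\<lambda>k. congr X (A k)) \<nu> $ i $ j = \<nu> \<bullet> (\<chi> k. congr X (A k) $ i $ j)" for i j
    by (simp add: lin_comb_def sum_component inner_vec_def)
  then show ?thesis
    by (simp add: vec_eq_iff congr_entry inner_lin_comb)
qed

lemma lin_comb_perturb: "lin_comb (perturb A E \<epsilon>) \<nu> = lin_comb A \<nu> + \<epsilon> *\<^sub>R lin_comb E \<nu>"
  by (simp add: lin_comb_def perturb_def scaleR_add_right sum.distrib scaleR_sum_right mult.commute)

section \<open>Eigenvalue vectors as weights of a joint diagonal form\<close>

text \<open>The weights of the diagonal form of \<open>A k\<close> factor as \<open>\<delta> l * \<Lambda> l $ k\<close>, because the eigenvalue vectors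
  are the diagonals divided by those of the invertible combination \<open>lin_comb A t\<close>, whose entries are \<open>\<delta> l\<close>.
  Relative to itself that combination has only the eigenvalue \<open>1\<close>, so \<open>t \<bullet> \<Lambda> l = 1\<close>; this normalization
  makes distinct eigenvalue vectors linearly independent.\<close>

lemma eigenvalue_vectors_decomposition:
  fixes A :: "'d::finite \<Rightarrow> real^'n^'n"
  assumes "num_eigenvalue_vectors A m"
  obtains \<Lambda> :: "'n \<Rightarrow> real^'d" and \<delta> :: "'n \<Rightarrow> real" and X :: "real^'n^'n" and t :: "real^'d"
  where "m = card (range \<Lambda>)" "\<And>l. t \<bullet> \<Lambda> l = 1" "\<And>l. \<delta> l \<noteq> 0" "invertible X"
    "\<And>k i j. congr X (A k) $ i $ j = (if i = j then \<delta> i * \<Lambda> i $ k else 0)"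
proof -
  obtain X t where X: "diagonalizes X A" and t: "invertible (lin_comb A t)"
    and m: "m = card (eigenvalue_vectors A X t)"
    using assms by (auto simp: num_eigenvalue_vectors_def)
  define D where "D k = congr X (A k)" for k
  define Dt where "Dt = lin_comb D t"
  define Di where "Di = matrix_inv Dt"
  define \<delta> where "\<delta> i = Dt $ i $ i" for i
  define \<Lambda> where "\<Lambda> i = (\<chi> k. (D k ** Di) $ i $ i)" for i
  have X': "invertible X" and D: "\<And>k i j. i \<noteq> j \<Longrightarrow> D k $ i $ j = 0"
    using X by (auto simp: diagonalizes_def is_diagonal_def D_def)
  have Dt_nth: "Dt $ i $ j = (\<Sum>k\<in>UNIV. t $ k * D k $ i $ j)" for i j
    by (simp add: Dt_def lin_comb_def sum_component)
  have Dt: "Dt $ i $ j = 0" if "i \<noteq> j" for i j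
    using D that by (simp add: Dt_nth)
  have "Dt = transpose X ** lin_comb A t ** X"
    by (simp add: Dt_def D_def[abs_def] lin_comb_congr) (simp add: congr_def)
  then have "invertible Dt"
    using X' t by (simp add: invertible_mult transpose_invertible)
  then have inv: "Dt ** Di = mat 1"
    unfolding Di_def by (rule matrix_mult_matrix_inv)
  have diag_mult: "(M ** N) $ i $ i = M $ i $ i * N $ i $ i" if "\<And>j. i \<noteq> j \<Longrightarrow> M $ i $ j = 0"
    for M N :: "real^'n^'n" and i
  proof -
    have "(M ** N) $ i $ i = (\<Sum>j\<in>UNIV. M $ i $ j * N $ j $ i)"
      by (simp add: matrix_matrix_mult_def)
    also have "\<dots> = (\<Sum>j\<in>UNIV. if j = i then M $ i $ i * N $ i $ i else 0)"
      by (intro sum.cong) (use that in auto)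
    finally show ?thesis by simp
  qed
  have "\<delta> i * Di $ i $ i = 1" for i
    using diag_mult[of i Dt Di] Dt by (simp add: inv \<delta>_def mat_def)
  then have \<delta>: "\<delta> i \<noteq> 0" and Di: "Di $ i $ i = 1 / \<delta> i" for i
    by (metis mult_zero_left zero_neq_one, metis mult_zero_left nonzero_eq_divide_eq mult.commute zero_neq_one)
  have \<Lambda>: "\<Lambda> i $ k = D k $ i $ i / \<delta> i" for i k
    using diag_mult[of i "D k" Di] D by (simp add: \<Lambda>_def Di)
  show ?thesis
  proof (rule that[of \<Lambda> t \<delta> X])
    show "m = card (range \<Lambda>)"
      by (simp add: m eigenvalue_vectors_def \<Lambda>_def[abs_def] D_def[abs_def] Di_def Dt_def Let_def)
    show "t \<bullet> \<Lambda> l = 1" for l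
    proof -
      have "t \<bullet> \<Lambda> l = Dt $ l $ l / \<delta> l"
        unfolding Dt_nth by (simp add: inner_vec_def \<Lambda> sum_divide_distrib)
      then show ?thesis using \<delta>[of l] by (simp add: \<delta>_def)
    qed
    show "congr X (A k) $ i $ j = (if i = j then \<delta> i * \<Lambda> i $ k else 0)" for k i j
      using D[of i j k] \<delta> by (simp add: D_def[symmetric] \<Lambda>)
  qed (use \<delta> X' in auto)
qed

text \<open>The bilinear forms of the family, collected into one vector indexed by \<open>k\<close>, are a combination
  of the eigenvalue vectors. This is the form in which the family enters everything below.\<close>

lemma congr_form:
  fixes X0 :: "real^'n^'n" and A :: "'d::finite \<Rightarrow> real^'n^'n" and \<Lambda> :: "'n \<Rightarrow> real^'d"
  assumes X0: "invertible X0"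
    and diag: "\<And>k i j. congr X0 (A k) $ i $ j = (if i = j then \<delta> i * \<Lambda> i $ k else 0)"
  shows "(\<chi> k. x \<bullet> (A k *v y)) =
    (\<Sum>l\<in>UNIV. (\<delta> l * (matrix_inv X0 *v x) $ l * (matrix_inv X0 *v y) $ l) *\<^sub>R \<Lambda> l)"
proof -
  have inv: "X0 *v (matrix_inv X0 *v v) = v" for v
    by (simp add: matrix_vector_mul_assoc matrix_mult_matrix_inv[OF X0])
  let ?x = "matrix_inv X0 *v x" and ?y = "matrix_inv X0 *v y"
  have row: "(congr X0 (A k) *v ?y) $ l = \<delta> l * \<Lambda> l $ k * ?y $ l" for k l
  proof -
    have "(congr X0 (A k) *v ?y) $ l = (\<Sum>j\<in>UNIV. congr X0 (A k) $ l $ j * ?y $ j)"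
      by (simp add: matrix_vector_mult_def)
    also have "\<dots> = (\<Sum>j\<in>UNIV. if j = l then \<delta> l * \<Lambda> l $ k * ?y $ l else 0)"
      by (intro sum.cong) (auto simp: diag)
    finally show ?thesis by simp
  qed
  have "x \<bullet> (A k *v y) = ?x \<bullet> (congr X0 (A k) *v ?y)" for k
    by (simp add: inner_congr inv)
  then show ?thesis
    by (simp add: vec_eq_iff inner_vec_def row sum_component mult_ac)
qed

section \<open>Oblique projections onto planes of eigenvalue vectors\<close>

text \<open>The map \<open>x \<mapsto> (\<theta> \<bullet> x) a + (\<mu> \<bullet> x) b\<close> that fixes \<open>g\<close> and \<open>h\<close> is the projection onto their span along the
  orthogonal complement of \<open>\<theta>\<close> and \<open>\<mu>\<close>, and \<open>r\<close> bounds its operator norm. For \<open>g = h\<close> a projection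
  onto a line suffices. The determinant condition says that no nontrivial combination of \<open>\<theta>\<close> and
  \<open>\<mu>\<close> is orthogonal to both \<open>g\<close> and \<open>h\<close>.\<close>

definition well_conditioned :: "'v::real_inner set \<Rightarrow> 'v \<Rightarrow> 'v \<Rightarrow> real \<Rightarrow> bool" where
  "well_conditioned V \<theta> \<mu> r \<longleftrightarrow> (\<forall>g\<in>V. \<forall>h\<in>V.
     (g \<noteq> h \<longrightarrow> (\<theta> \<bullet> g) * (\<mu> \<bullet> h) \<noteq> (\<theta> \<bullet> h) * (\<mu> \<bullet> g)) \<and>
     (\<exists>a b. (\<theta> \<bullet> g) *\<^sub>R a + (\<mu> \<bullet> g) *\<^sub>R b = g \<and> (\<theta> \<bullet> h) *\<^sub>R a + (\<mu> \<bullet> h) *\<^sub>R b = h \<and>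
        norm a * norm \<theta> + norm b * norm \<mu> \<le> r))"

text \<open>The unit vector in the span of \<open>g\<close> and \<open>h\<close> that is orthogonal to \<open>x\<close>. In the degenerate case, where
  this does not determine it, any fixed unit vector serves: the value then has norm \<open>1\<close> for every \<open>x\<close>,
  as the Gaussian estimate for random directions requires.\<close>

definition orthogonal_direction :: "'v::euclidean_space \<Rightarrow> 'v \<Rightarrow> 'v \<Rightarrow> 'v" where
  "orthogonal_direction g h x =
     (if (x \<bullet> h) *\<^sub>R g - (x \<bullet> g) *\<^sub>R h = 0 then SOME b. b \<in> Basis
      else sgn ((x \<bullet> h) *\<^sub>R g - (x \<bullet> g) *\<^sub>R h))"

lemma norm_orthogonal_direction: "norm (orthogonal_direction g h x) = 1"
  using norm_Basis[OF SOME_Basis] by (auto simp: orthogonal_direction_def norm_sgn)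

lemma borel_measurable_orthogonal_direction [measurable]:
  "orthogonal_direction g h \<in> borel_measurable borel"
  unfolding orthogonal_direction_def[abs_def] sgn_div_norm by measurable

lemma sum_le_of_square_sum_le:
  fixes x y c :: real
  assumes "x\<^sup>2 + y\<^sup>2 \<le> c\<^sup>2" "c \<ge> 0"
  shows "x + y \<le> sqrt 2 * c"
proof (rule power2_le_imp_le)
  have "(x + y)\<^sup>2 \<le> 2 * (x\<^sup>2 + y\<^sup>2)"
    using sum_squares_ge_zero[of "x - y" 0] by (simp add: power2_eq_square algebra_simps)
  then show "(x + y)\<^sup>2 \<le> (sqrt 2 * c)\<^sup>2"
    using assms by (simp add: power_mult_distrib)
qed (use assms in simp)

text \<open>The coefficient \<open>a\<close> of the projection must be orthogonal to \<open>\<mu>\<close> and have inner product \<open>1\<close> with \<open>\<theta>\<close>,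
  so it is a unit vector orthogonal to \<open>\<mu>\<close> divided by its inner product with \<open>\<theta>\<close>, and its norm is less
  than \<open>1 / \<tau>\<close>; likewise for \<open>b\<close>. The vector \<open>t\<close> ensures that distinct elements of \<open>V\<close> are linearly
  independent, so that the plane and the directions in it are not degenerate.\<close>

lemma well_conditionedI:
  fixes \<theta> \<mu> t :: "'v::euclidean_space"
  assumes t: "\<And>g. g \<in> V \<Longrightarrow> t \<bullet> g = 1" and "\<tau> > 0" "c \<ge> 0"
    and norms: "(norm \<theta>)\<^sup>2 + (norm \<mu>)\<^sup>2 \<le> c\<^sup>2"
    and single: "\<And>g. g \<in> V \<Longrightarrow> \<tau> < \<bar>\<mu> \<bullet> sgn g\<bar>"
    and pair: "\<And>g h. g \<in> V \<Longrightarrow> h \<in> V \<Longrightarrow> g \<noteq> h \<Longrightarrow> \<tau> < \<bar>\<theta> \<bullet> orthogonal_direction g h \<mu>\<bar>"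
      "\<And>g h. g \<in> V \<Longrightarrow> h \<in> V \<Longrightarrow> g \<noteq> h \<Longrightarrow> \<tau> < \<bar>\<mu> \<bullet> orthogonal_direction g h \<theta>\<bar>"
  shows "well_conditioned V \<theta> \<mu> (sqrt 2 * c / \<tau>)"
  unfolding well_conditioned_def
proof (intro ballI)
  fix g h assume V: "g \<in> V" "h \<in> V"
  have \<mu>g: "\<mu> \<bullet> g \<noteq> 0"
    using single[OF V(1)] \<open>\<tau> > 0\<close> by (auto simp: sgn_div_norm)
  have sum: "norm \<theta> + norm \<mu> \<le> sqrt 2 * c"
    by (rule sum_le_of_square_sum_le[OF norms \<open>c \<ge> 0\<close>])
  have inv: "norm (v /\<^sub>R s) \<le> 1 / \<tau>" if "norm v = 1" "\<tau> < \<bar>s\<bar>" for v :: 'v and s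
    using that \<open>\<tau> > 0\<close> by (simp add: divide_inverse le_imp_inverse_le)
  show "(g \<noteq> h \<longrightarrow> (\<theta> \<bullet> g) * (\<mu> \<bullet> h) \<noteq> (\<theta> \<bullet> h) * (\<mu> \<bullet> g)) \<and>
     (\<exists>a b. (\<theta> \<bullet> g) *\<^sub>R a + (\<mu> \<bullet> g) *\<^sub>R b = g \<and> (\<theta> \<bullet> h) *\<^sub>R a + (\<mu> \<bullet> h) *\<^sub>R b = h \<and>
        norm a * norm \<theta> + norm b * norm \<mu> \<le> sqrt 2 * c / \<tau>)"
  proof (cases "g = h")
    case True
    define b where "b = sgn g /\<^sub>R (\<mu> \<bullet> sgn g)"
    have "g \<noteq> 0" using \<mu>g by auto
    have "norm b \<le> 1 / \<tau>"
      unfolding b_def using single[OF V(1)] \<open>g \<noteq> 0\<close> by (intro inv) (auto simp: norm_sgn)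
    then have "norm b * norm \<mu> \<le> 1 / \<tau> * norm \<mu>"
      by (intro mult_right_mono) auto
    also have "\<dots> \<le> 1 / \<tau> * (sqrt 2 * c)"
      using sum \<open>\<tau> > 0\<close> by (intro mult_left_mono) (auto intro: order_trans[rotated])
    finally have "norm b * norm \<mu> \<le> sqrt 2 * c / \<tau>" by simp
    moreover have "(\<mu> \<bullet> g) *\<^sub>R b = g"
      using \<mu>g \<open>g \<noteq> 0\<close> by (simp add: b_def sgn_div_norm field_simps)
    ultimately show ?thesis
      using True by (intro conjI exI[of _ 0] exI[of _ b]) auto
  next
    case False
    let ?w = "\<lambda>x. (x \<bullet> h) *\<^sub>R g - (x \<bullet> g) *\<^sub>R h" and ?v = "orthogonal_direction g h"
    define a where "a = ?v \<mu> /\<^sub>R (\<theta> \<bullet> ?v \<mu>)"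
    define b where "b = ?v \<theta> /\<^sub>R (\<mu> \<bullet> ?v \<theta>)"
    \<comment> \<open>The numerators of \<open>a\<close> and \<open>b\<close> are \<open>?w \<mu>\<close> and \<open>?w \<theta>\<close>; their inner products with \<open>\<theta>\<close> and \<open>\<mu>\<close> are \<open>D\<close> and \<open>- D\<close>.\<close>
    define D where "D = (\<theta> \<bullet> g) * (\<mu> \<bullet> h) - (\<theta> \<bullet> h) * (\<mu> \<bullet> g)"
    have w\<mu>: "?w \<mu> \<noteq> 0"
    proof
      assume 0: "?w \<mu> = 0"
      then have "t \<bullet> ?w \<mu> = 0" by simp
      then have "\<mu> \<bullet> h = \<mu> \<bullet> g"
        using t[OF V(1)] t[OF V(2)] by (simp add: inner_diff_right)
      with 0 have "(\<mu> \<bullet> g) *\<^sub>R (g - h) = 0" by (simp add: algebra_simps)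
      with \<mu>g False show False by simp
    qed
    have D\<theta>: "\<theta> \<bullet> ?w \<mu> = D" and D\<mu>: "\<mu> \<bullet> ?w \<theta> = - D"
      by (simp_all add: D_def inner_diff_right algebra_simps)
    have "\<theta> \<bullet> ?v \<mu> \<noteq> 0"
      using pair(1)[OF V False] \<open>\<tau> > 0\<close> by auto
    with w\<mu> D\<theta> have "D \<noteq> 0"
      by (auto simp: orthogonal_direction_def sgn_div_norm)
    with D\<mu> have w\<theta>: "?w \<theta> \<noteq> 0" by auto
    have a: "a = ?w \<mu> /\<^sub>R D" 
      using w\<mu> D\<theta> by (simp add: a_def orthogonal_direction_def sgn_div_norm)
    have b: "b = - (?w \<theta> /\<^sub>R D)"
      using w\<theta> D\<mu> by (simp add: b_def orthogonal_direction_def sgn_div_norm)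
    have Dg: "(\<theta> \<bullet> g) *\<^sub>R ?w \<mu> - (\<mu> \<bullet> g) *\<^sub>R ?w \<theta> = D *\<^sub>R g"
      by (simp add: D_def algebra_simps)
    have Dh: "(\<theta> \<bullet> h) *\<^sub>R ?w \<mu> - (\<mu> \<bullet> h) *\<^sub>R ?w \<theta> = D *\<^sub>R h"
      by (simp add: D_def algebra_simps)
    have g: "(\<theta> \<bullet> g) *\<^sub>R a + (\<mu> \<bullet> g) *\<^sub>R b = g"
    proof -
      have "(\<theta> \<bullet> g) *\<^sub>R a + (\<mu> \<bullet> g) *\<^sub>R b = ((\<theta> \<bullet> g) *\<^sub>R ?w \<mu> - (\<mu> \<bullet> g) *\<^sub>R ?w \<theta>) /\<^sub>R D"
        by (simp add: a b algebra_simps)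
      then show ?thesis using Dg \<open>D \<noteq> 0\<close> by simp
    qed
    have h: "(\<theta> \<bullet> h) *\<^sub>R a + (\<mu> \<bullet> h) *\<^sub>R b = h"
    proof -
      have "(\<theta> \<bullet> h) *\<^sub>R a + (\<mu> \<bullet> h) *\<^sub>R b = ((\<theta> \<bullet> h) *\<^sub>R ?w \<mu> - (\<mu> \<bullet> h) *\<^sub>R ?w \<theta>) /\<^sub>R D"
        by (simp add: a b algebra_simps)
      then show ?thesis using Dh \<open>D \<noteq> 0\<close> by simp
    qed
    have "norm a * norm \<theta> + norm b * norm \<mu> \<le> 1 / \<tau> * norm \<theta> + 1 / \<tau> * norm \<mu>"
      unfolding a_def b_def using pair[OF V False]
      by (intro add_mono mult_right_mono inv norm_orthogonal_direction) auto
    also have "\<dots> = (norm \<theta> + norm \<mu>) / \<tau>" by (simp add: add_divide_distrib)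
    also have "\<dots> \<le> sqrt 2 * c / \<tau>"
      using sum \<open>\<tau> > 0\<close> by (intro divide_right_mono) auto
    finally show ?thesis
      using g h \<open>D \<noteq> 0\<close> by (auto simp: D_def)
  qed
qed

text \<open>Let \<open>\<Phi>\<close> be the projection. It annihilates \<open>q + e\<close> and fixes the main part \<open>q - p\<close>, so \<open>q + e\<close> equals
  \<open>(I - \<Phi>) (p + e)\<close>: of \<open>q\<close>, which may be as large as \<open>e\<close>, only the small remainder \<open>p\<close> matters.\<close>

lemma well_conditioned_error:
  fixes \<theta> \<mu> :: "'v::real_inner"
  assumes wc: "well_conditioned V \<theta> \<mu> r" and gh: "g \<in> V" "h \<in> V" and "finite I"
    and U: "\<And>l. l \<in> I \<Longrightarrow> u l \<in> {g, h}"
    and q: "q = (\<Sum>l\<in>I. c l *\<^sub>R u l) + p"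
    and orth: "\<theta> \<bullet> (q + e) = 0" "\<mu> \<bullet> (q + e) = 0"
  shows "norm (q + e) \<le> (r + 1) * (norm p + norm e)"
proof -
  obtain a b where fixed: "(\<theta> \<bullet> g) *\<^sub>R a + (\<mu> \<bullet> g) *\<^sub>R b = g" "(\<theta> \<bullet> h) *\<^sub>R a + (\<mu> \<bullet> h) *\<^sub>R b = h"
    and r: "norm a * norm \<theta> + norm b * norm \<mu> \<le> r"
    using wc gh unfolding well_conditioned_def by metis
  define \<Phi> where "\<Phi> x = (\<theta> \<bullet> x) *\<^sub>R a + (\<mu> \<bullet> x) *\<^sub>R b" for x
  have \<Phi>_linear: "linear \<Phi>"
    by (simp add: \<Phi>_def linear_iff inner_add_right algebra_simps)
  have \<Phi>_norm: "norm (\<Phi> x) \<le> r * norm x" for x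
  proof -
    have "norm (\<Phi> x) \<le> \<bar>\<theta> \<bullet> x\<bar> * norm a + \<bar>\<mu> \<bullet> x\<bar> * norm b"
      unfolding \<Phi>_def by (rule order_trans[OF norm_triangle_ineq]) simp
    also have "\<dots> \<le> (norm \<theta> * norm x) * norm a + (norm \<mu> * norm x) * norm b"
      by (intro add_mono mult_right_mono Cauchy_Schwarz_ineq2) auto
    also have "\<dots> = (norm a * norm \<theta> + norm b * norm \<mu>) * norm x"
      by (simp add: algebra_simps)
    also have "\<dots> \<le> r * norm x"
      using r by (intro mult_right_mono) auto
    finally show ?thesis .
  qed
  have "\<Phi> (u l) = u l" if "l \<in> I" for l
    using U[OF that] fixed by (auto simp: \<Phi>_def)
  then have "\<Phi> (\<Sum>l\<in>I. c l *\<^sub>R u l) = (\<Sum>l\<in>I. c l *\<^sub>R u l)"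
    by (simp add: linear_sum[OF \<Phi>_linear] linear_cmul[OF \<Phi>_linear])
  then have "\<Phi> (q + e) = (q - p) + \<Phi> (p + e)"
    by (simp add: q linear_add[OF \<Phi>_linear])
  moreover have "\<Phi> (q + e) = 0"
    using orth by (simp add: \<Phi>_def)
  ultimately have "q + e = (p + e) - \<Phi> (p + e)"
    by (simp add: algebra_simps)
  then have "norm (q + e) \<le> norm (p + e) + norm (\<Phi> (p + e))"
    using norm_triangle_ineq4 by metis
  also have "\<dots> \<le> (r + 1) * norm (p + e)"
    using \<Phi>_norm[of "p + e"] by (simp add: algebra_simps)
  also have "\<dots> \<le> (r + 1) * (norm p + norm e)"
  proof (rule mult_left_mono)
    have "0 \<le> norm a * norm \<theta> + norm b * norm \<mu>" by simp
    then show "0 \<le> r + 1" using r by linarith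
  qed (rule norm_triangle_ineq)
  finally show ?thesis .
qed

section \<open>Localization of perturbed eigenvectors\<close>

text \<open>If \<open>s\<close> and \<open>t\<close> are the \<open>i\<close>-th diagonal entries of the two diagonal forms, then \<open>t M - s N\<close> annihilates the
  \<open>i\<close>-th column of \<open>X\<close>. Divided by the larger of the two absolute values, these coefficients stay
  bounded uniformly in \<open>X\<close>, unlike the eigenvalue \<open>s / t\<close>. When \<open>s = t = 0\<close>, both matrices annihilate
  the column.\<close>

lemma simultaneous_eigenvector:
  fixes M N X :: "real^'n^'n"
  assumes X: "invertible X" and M: "is_diagonal (congr X M)" and N: "is_diagonal (congr X N)"
  obtains \<alpha> \<beta> :: real where "max \<bar>\<alpha>\<bar> \<bar>\<beta>\<bar> = 1"
    "\<alpha> *\<^sub>R (M *v column i X) + \<beta> *\<^sub>R (N *v column i X) = 0"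
proof -
  define s where "s = congr X M $ i $ i"
  define t where "t = congr X N $ i $ i"
  have ker: "v = 0" if "\<And>j. column j X \<bullet> v = 0" for v
  proof -
    have "transpose X *v v = 0"
      using that by (simp add: vec_eq_iff matrix_vector_mul_component transpose_def column_def 
        inner_vec_def matrix_vector_mult_def del: transpose_matrix_vector)
    then show ?thesis
      using X by (metis invertible_def matrix_left_invertible_ker transpose_invertible)
  qed
  have eq: "\<alpha> *\<^sub>R (M *v column i X) + \<beta> *\<^sub>R (N *v column i X) = 0" if "\<alpha> * s + \<beta> * t = 0" for \<alpha> \<beta>
  proof (rule ker)
    fix j
    have "column j X \<bullet> (\<alpha> *\<^sub>R (M *v column i X) + \<beta> *\<^sub>R (N *v column i X)) =
      \<alpha> * congr X M $ j $ i + \<beta> * congr X N $ j $ i"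
      by (simp add: congr_entry inner_add_right)
    also have "\<dots> = 0"
      using that M N by (cases "i = j") (auto simp: s_def t_def is_diagonal_def)
    finally show "column j X \<bullet> (\<alpha> *\<^sub>R (M *v column i X) + \<beta> *\<^sub>R (N *v column i X)) = 0" .
  qed
  define c where "c = max \<bar>s\<bar> \<bar>t\<bar>"
  show ?thesis
  proof (cases "c = 0")
    case True
    then have "s = 0" "t = 0" by (auto simp: c_def max_def split: if_splits)
    then show ?thesis using eq[of 1 0] by (intro that[of 1 0]) auto
  next
    case False
    then have "c > 0" by (auto simp: c_def)
    then have "max \<bar>t / c\<bar> \<bar>- s / c\<bar> = 1"
      by (auto simp: max_def c_def field_simps)
    moreover have "t / c * s + (- s / c) * t = 0" by simp
    ultimately show ?thesis using eq that by blast
  qed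
qed

lemma finite_uniform_positive_bound:
  fixes f :: "'b \<Rightarrow> real"
  assumes "finite S" and "\<And>p. p \<in> S \<Longrightarrow> f p > 0"
  obtains c where "c > 0" "\<And>p. p \<in> S \<Longrightarrow> c \<le> f p"
proof (rule that[of "Min (insert 1 (f ` S))"])
  show "Min (insert 1 (f ` S)) > 0"
    using assms by (subst Min_gr_iff) auto
  show "Min (insert 1 (f ` S)) \<le> f p" if "p \<in> S" for p
    using assms(1) that by (intro Min_le) auto
qed

text \<open>Only one of the linear functionals \<open>(\<theta> \<bullet> g, \<mu> \<bullet> g)\<close>, for \<open>g\<close> in \<open>V\<close>, can be small at a normalized
  \<open>(\<alpha>, \<beta>)\<close>: by Cramer's rule, values \<open>x\<close> and \<open>y\<close> at \<open>g\<close> and \<open>h\<close> determine \<open>\<alpha>\<close> and \<open>\<beta>\<close>, up to the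
  determinant, as combinations of \<open>x\<close> and \<open>y\<close>.\<close>

lemma separation_bound:
  fixes V :: "'v::real_inner set" and \<theta> \<mu> :: 'v
  assumes "finite V"
    and det: "\<And>g h. g \<in> V \<Longrightarrow> h \<in> V \<Longrightarrow> g \<noteq> h \<Longrightarrow> (\<theta> \<bullet> g) * (\<mu> \<bullet> h) \<noteq> (\<theta> \<bullet> h) * (\<mu> \<bullet> g)"
  obtains c where "c > 0"
    "\<And>\<alpha> \<beta> g h. max \<bar>\<alpha>\<bar> \<bar>\<beta>\<bar> = 1 \<Longrightarrow> g \<in> V \<Longrightarrow> h \<in> V \<Longrightarrow> g \<noteq> h \<Longrightarrow>
       \<bar>\<alpha> * (\<theta> \<bullet> g) + \<beta> * (\<mu> \<bullet> g)\<bar> < c \<Longrightarrow> c \<le> \<bar>\<alpha> * (\<theta> \<bullet> h) + \<beta> * (\<mu> \<bullet> h)\<bar>"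
proof -
  define D where "D g h = (\<theta> \<bullet> g) * (\<mu> \<bullet> h) - (\<theta> \<bullet> h) * (\<mu> \<bullet> g)" for g h
  define L where "L g h = \<bar>\<theta> \<bullet> g\<bar> + \<bar>\<theta> \<bullet> h\<bar> + \<bar>\<mu> \<bullet> g\<bar> + \<bar>\<mu> \<bullet> h\<bar>" for g h
  define S where "S = {p \<in> V \<times> V. fst p \<noteq> snd p}"
  have L: "L g h > 0" if "D g h \<noteq> 0" for g h
  proof (rule ccontr)
    assume "\<not> L g h > 0"
    then have "\<theta> \<bullet> g = 0" "\<theta> \<bullet> h = 0" unfolding L_def by linarith+
    with that show False by (simp add: D_def)
  qed
  have "finite S" using \<open>finite V\<close> by (simp add: S_def)
  moreover have "\<bar>D (fst p) (snd p)\<bar> / L (fst p) (snd p) > 0" if "p \<in> S" for p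
  proof -
    have "D (fst p) (snd p) \<noteq> 0" using that det by (auto simp: S_def D_def)
    then show ?thesis using L by (intro divide_pos_pos) auto
  qed
  ultimately obtain c where "c > 0"
    and c: "\<And>p. p \<in> S \<Longrightarrow> c \<le> \<bar>D (fst p) (snd p)\<bar> / L (fst p) (snd p)"
    using finite_uniform_positive_bound[of S "\<lambda>p. \<bar>D (fst p) (snd p)\<bar> / L (fst p) (snd p)"] by metis
  show ?thesis
  proof (rule that[OF \<open>c > 0\<close>])
    fix \<alpha> \<beta> g h
    assume \<alpha>\<beta>: "max \<bar>\<alpha>\<bar> \<bar>\<beta>\<bar> = 1" and V: "g \<in> V" "h \<in> V" "g \<noteq> h"
      and small: "\<bar>\<alpha> * (\<theta> \<bullet> g) + \<beta> * (\<mu> \<bullet> g)\<bar> < c"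
    define x where "x = \<alpha> * (\<theta> \<bullet> g) + \<beta> * (\<mu> \<bullet> g)"
    define y where "y = \<alpha> * (\<theta> \<bullet> h) + \<beta> * (\<mu> \<bullet> h)"
    show "c \<le> \<bar>\<alpha> * (\<theta> \<bullet> h) + \<beta> * (\<mu> \<bullet> h)\<bar>"
    proof (rule ccontr)
      assume "\<not> ?thesis"
      then have y: "\<bar>y\<bar> < c" and x: "\<bar>x\<bar> < c" using small by (auto simp: x_def y_def)
      have D0: "D g h \<noteq> 0" using det[OF V] by (simp add: D_def)
      have bound: "\<bar>x * p - y * q\<bar> \<le> max \<bar>x\<bar> \<bar>y\<bar> * L g h" if "\<bar>p\<bar> + \<bar>q\<bar> \<le> L g h" for p q
      proof -
        have "\<bar>x * p - y * q\<bar> \<le> \<bar>x\<bar> * \<bar>p\<bar> + \<bar>y\<bar> * \<bar>q\<bar>"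
          by (metis abs_mult abs_triangle_ineq4)
        also have "\<dots> \<le> max \<bar>x\<bar> \<bar>y\<bar> * (\<bar>p\<bar> + \<bar>q\<bar>)"
          unfolding distrib_left by (intro add_mono mult_right_mono) auto
        also have "\<dots> \<le> max \<bar>x\<bar> \<bar>y\<bar> * L g h"
          using that by (intro mult_left_mono) auto
        finally show ?thesis .
      qed
      have "\<alpha> * D g h = x * (\<mu> \<bullet> h) - y * (\<mu> \<bullet> g)" "\<beta> * D g h = y * (\<theta> \<bullet> g) - x * (\<theta> \<bullet> h)"
        by (simp_all add: D_def x_def y_def algebra_simps)
      moreover have "\<bar>D g h\<bar> = \<bar>\<alpha> * D g h\<bar> \<or> \<bar>D g h\<bar> = \<bar>\<beta> * D g h\<bar>"
        using \<alpha>\<beta> by (auto simp: abs_mult max_def split: if_splits)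
      ultimately have "\<bar>D g h\<bar> \<le> max \<bar>x\<bar> \<bar>y\<bar> * L g h"
        using bound[of "\<mu> \<bullet> h" "\<mu> \<bullet> g"] bound[of "\<theta> \<bullet> h" "\<theta> \<bullet> g"]
        by (auto simp: abs_minus_commute L_def)
      also have "\<dots> < c * L g h"
        using x y L[OF D0] by (intro mult_strict_right_mono) auto
      also have "\<dots> \<le> \<bar>D g h\<bar>"
        using c[of "(g, h)"] V L[OF D0] by (simp add: S_def field_simps)
      finally show False by simp
    qed
  qed
qed

text \<open>Test the equation of \<open>simultaneous_eigenvector\<close> for a column \<open>x\<close> of \<open>X\<close> against the \<open>l\<close>-th column of \<open>X0\<close>. The
  unperturbed part is \<open>\<alpha> (\<theta> \<bullet> \<Lambda> l) + \<beta> (\<mu> \<bullet> \<Lambda> l)\<close> times \<open>\<delta> l\<close> times the \<open>l\<close>-th coordinate of \<open>x\<close>, and the perturbation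
  is \<open>O(\<epsilon>)\<close>. By \<open>separation_bound\<close> the first factor is bounded below except for one eigenvalue vector \<open>g\<close>.\<close>

lemma eigenvector_localization:
  fixes A E :: "'d::finite \<Rightarrow> real^'n^'n" and \<Lambda> :: "'n \<Rightarrow> real^'d" and X0 :: "real^'n^'n"
  assumes \<delta>: "\<And>l. \<delta> l \<noteq> 0" and X0: "invertible X0"
    and diag: "\<And>k i j. congr X0 (A k) $ i $ j = (if i = j then \<delta> i * \<Lambda> i $ k else 0)"
    and wc: "well_conditioned (range \<Lambda>) \<theta> \<mu> r"
  obtains C where "C \<ge> 0"
    "\<And>\<epsilon> X i. \<epsilon> > 0 \<Longrightarrow> invertible X \<Longrightarrow>
       is_diagonal (congr X (lin_comb (perturb A E \<epsilon>) \<mu>)) \<Longrightarrow>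
       is_diagonal (congr X (lin_comb (perturb A E \<epsilon>) \<theta>)) \<Longrightarrow>
       \<exists>g\<in>range \<Lambda>. \<forall>l. \<Lambda> l \<noteq> g \<longrightarrow>
         \<bar>(matrix_inv X0 *v column i X) $ l\<bar> \<le> C * \<epsilon> * spectral_norm X"
proof -
  obtain c where "c > 0" and c:
    "\<And>\<alpha> \<beta> g h. max \<bar>\<alpha>\<bar> \<bar>\<beta>\<bar> = 1 \<Longrightarrow> g \<in> range \<Lambda> \<Longrightarrow> h \<in> range \<Lambda> \<Longrightarrow> g \<noteq> h \<Longrightarrow>
       \<bar>\<alpha> * (\<theta> \<bullet> g) + \<beta> * (\<mu> \<bullet> g)\<bar> < c \<Longrightarrow> c \<le> \<bar>\<alpha> * (\<theta> \<bullet> h) + \<beta> * (\<mu> \<bullet> h)\<bar>"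
    using separation_bound[of "range \<Lambda>" \<theta> \<mu>] wc unfolding well_conditioned_def by (metis finite finite_imageI)
  define K where "K = spectral_norm (lin_comb E \<theta>) + spectral_norm (lin_comb E \<mu>)"
  define C where "C = (\<Sum>l\<in>UNIV. norm (column l X0) * K / (\<bar>\<delta> l\<bar> * c))"
  have "K \<ge> 0" by (simp add: K_def spectral_norm_nonneg)
  have C_ge: "norm (column l X0) * K / (\<bar>\<delta> l\<bar> * c) \<le> C" for l
    unfolding C_def using \<open>K \<ge> 0\<close> \<open>c > 0\<close> by (intro member_le_sum) auto
  show ?thesis
  proof (rule that[of C])
    show "C \<ge> 0"
      unfolding C_def using \<open>K \<ge> 0\<close> \<open>c > 0\<close> by (intro sum_nonneg) auto
    fix \<epsilon> :: real and X :: "real^'n^'n" and i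
    assume "\<epsilon> > 0" and X: "invertible X"
      "is_diagonal (congr X (lin_comb (perturb A E \<epsilon>) \<mu>))"
      "is_diagonal (congr X (lin_comb (perturb A E \<epsilon>) \<theta>))"
    define x where "x = column i X"
    define z where "z = matrix_inv X0 *v x"
    obtain \<alpha> \<beta> where \<alpha>\<beta>: "max \<bar>\<alpha>\<bar> \<bar>\<beta>\<bar> = 1" and
      eq: "\<alpha> *\<^sub>R (lin_comb (perturb A E \<epsilon>) \<theta> *v x) + \<beta> *\<^sub>R (lin_comb (perturb A E \<epsilon>) \<mu> *v x) = 0"
      unfolding x_def by (rule simultaneous_eigenvector[OF X(1,3,2)])
    define p where "p g = \<alpha> * (\<theta> \<bullet> g) + \<beta> * (\<mu> \<bullet> g)" for g
    have coord: "\<bar>p (\<Lambda> l)\<bar> * \<bar>\<delta> l\<bar> * \<bar>z $ l\<bar> \<le> \<epsilon> * (norm (column l X0) * K * spectral_norm X)" for l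
    proof -
      define y where "y = column l X0"
      have "y = X0 *v axis l 1"
        by (simp add: y_def matrix_vector_mult_basis column_def)
      then have "matrix_inv X0 *v y = axis l 1"
        by (simp add: matrix_vector_mul_assoc matrix_inv_matrix_mult[OF X0])
      then have "(\<chi> k. y \<bullet> (A k *v x)) = (\<Sum>j\<in>UNIV. if j = l then (\<delta> l * z $ l) *\<^sub>R \<Lambda> l else 0)"
        unfolding congr_form[OF X0 diag] by (intro sum.cong) (auto simp: z_def axis_def)
      then have A_l: "y \<bullet> (lin_comb A \<nu> *v x) = (\<nu> \<bullet> \<Lambda> l) * \<delta> l * z $ l" for \<nu>
        by (simp add: inner_lin_comb)
      have "0 = y \<bullet> (\<alpha> *\<^sub>R (lin_comb (perturb A E \<epsilon>) \<theta> *v x) + \<beta> *\<^sub>R (lin_comb (perturb A E \<epsilon>) \<mu> *v x))"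
        by (simp add: eq)
      also have "\<dots> = p (\<Lambda> l) * \<delta> l * z $ l +
          \<epsilon> * (\<alpha> * (y \<bullet> (lin_comb E \<theta> *v x)) + \<beta> * (y \<bullet> (lin_comb E \<mu> *v x)))"
        by (simp add: lin_comb_perturb matrix_vector_mult_add_rdistrib inner_add_right A_l p_def
            scaleR_matrix_vector_assoc[symmetric] algebra_simps)
      finally have "\<bar>p (\<Lambda> l) * \<delta> l * z $ l\<bar> =
          \<bar>\<epsilon> * (\<alpha> * (y \<bullet> (lin_comb E \<theta> *v x)) + \<beta> * (y \<bullet> (lin_comb E \<mu> *v x)))\<bar>"
        by linarith
      also have "\<dots> = \<epsilon> * \<bar>\<alpha> * (y \<bullet> (lin_comb E \<theta> *v x)) + \<beta> * (y \<bullet> (lin_comb E \<mu> *v x))\<bar>"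
        using \<open>\<epsilon> > 0\<close> by (simp add: abs_mult)
      also have "\<dots> \<le> \<epsilon> * (norm y * K * spectral_norm X)"
      proof (rule mult_left_mono)
        have inner_le: "\<bar>s * (y \<bullet> (N *v x))\<bar> \<le> norm y * spectral_norm N * spectral_norm X"
          if "\<bar>s\<bar> \<le> 1" for s and N :: "real^'n^'n"
        proof -
          have "\<bar>s * (y \<bullet> (N *v x))\<bar> \<le> 1 * \<bar>y \<bullet> (N *v x)\<bar>"
            unfolding abs_mult using that by (intro mult_right_mono) auto
          also have "\<dots> \<le> norm y * norm (N *v x)"
            using Cauchy_Schwarz_ineq2[of y "N *v x"] by simp
          also have "\<dots> \<le> norm y * (spectral_norm N * norm x)"
            by (intro mult_left_mono norm_matrix_vector_le) simp
          also have "\<dots> \<le> norm y * (spectral_norm N * spectral_norm X)"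
            unfolding x_def by (intro mult_left_mono norm_column_le_onorm) (auto simp: spectral_norm_nonneg)
          finally show ?thesis by simp
        qed
        show "\<bar>\<alpha> * (y \<bullet> (lin_comb E \<theta> *v x)) + \<beta> * (y \<bullet> (lin_comb E \<mu> *v x))\<bar> \<le>
            norm y * K * spectral_norm X"
        proof -
          have "\<bar>\<alpha>\<bar> \<le> 1" "\<bar>\<beta>\<bar> \<le> 1" using \<alpha>\<beta> by linarith+
          then have "\<bar>\<alpha> * (y \<bullet> (lin_comb E \<theta> *v x))\<bar> + \<bar>\<beta> * (y \<bullet> (lin_comb E \<mu> *v x))\<bar> \<le>
              norm y * K * spectral_norm X"
            using inner_le[of \<alpha> "lin_comb E \<theta>"] inner_le[of \<beta> "lin_comb E \<mu>"]
            unfolding K_def by (simp add: algebra_simps)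
          then show ?thesis by linarith
        qed
      qed (use \<open>\<epsilon> > 0\<close> in simp)
      finally show ?thesis by (simp add: y_def abs_mult)
    qed
    obtain g where g: "g \<in> range \<Lambda>" "\<And>h. h \<in> range \<Lambda> \<Longrightarrow> h \<noteq> g \<Longrightarrow> c \<le> \<bar>p h\<bar>"
    proof (cases "\<exists>g\<in>range \<Lambda>. \<bar>p g\<bar> < c")
      case True
      then show ?thesis using c[OF \<alpha>\<beta>] that unfolding p_def by metis
    next
      case False
      then show ?thesis using that[of "\<Lambda> i"] by (auto simp: not_less)
    qed
    have "\<bar>z $ l\<bar> \<le> C * \<epsilon> * spectral_norm X" if "\<Lambda> l \<noteq> g" for l
    proof -
      have "c * (\<bar>\<delta> l\<bar> * \<bar>z $ l\<bar>) \<le> \<bar>p (\<Lambda> l)\<bar> * (\<bar>\<delta> l\<bar> * \<bar>z $ l\<bar>)"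
        using that g(2)[of "\<Lambda> l"] by (intro mult_right_mono) auto
      also have "\<dots> \<le> \<epsilon> * (norm (column l X0) * K * spectral_norm X)"
        using coord[of l] by simp
      finally have "\<bar>z $ l\<bar> \<le> (norm (column l X0) * K / (\<bar>\<delta> l\<bar> * c)) * (\<epsilon> * spectral_norm X)"
        using \<delta>[of l] \<open>c > 0\<close> by (simp add: field_simps)
      also have "\<dots> \<le> C * (\<epsilon> * spectral_norm X)"
        using C_ge[of l] \<open>\<epsilon> > 0\<close> by (intro mult_right_mono) (auto simp: spectral_norm_nonneg)
      finally show ?thesis by simp
    qed
    then show "\<exists>g\<in>range \<Lambda>. \<forall>l. \<Lambda> l \<noteq> g \<longrightarrow>
         \<bar>(matrix_inv X0 *v column i X) $ l\<bar> \<le> C * \<epsilon> * spectral_norm X"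
      using g(1) unfolding z_def x_def by blast
  qed
qed

section \<open>The deterministic error bound\<close>

text \<open>Minkowski's inequality, with the crude bound \<open>CARD('i) * c\<close> for the norm of a constant vector; it
  is applied to a constant of second order only.\<close>

lemma sqrt_sum_square_le:
  fixes a b f :: "'i::finite \<Rightarrow> real"
  assumes "\<And>p. 0 \<le> f p" "\<And>p. f p \<le> s * (c + a p)" "s \<ge> 0" "c \<ge> 0" "\<And>p. 0 \<le> a p"
  shows "sqrt (\<Sum>p\<in>UNIV. (f p)\<^sup>2) \<le> s * (real CARD('i) * c + sqrt (\<Sum>p\<in>UNIV. (a p)\<^sup>2))"
proof -
  have "L2_set f UNIV \<le> L2_set (\<lambda>p. s * (c + a p)) UNIV"
    using assms by (intro L2_set_mono) auto
  also have "\<dots> = s * L2_set (\<lambda>p. c + a p) UNIV"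
    using assms by (simp add: L2_set_right_distrib)
  also have "\<dots> \<le> s * (L2_set (\<lambda>p. c) (UNIV :: 'i set) + L2_set a UNIV)"
    using assms by (intro mult_left_mono L2_set_triangle_ineq) auto
  also have "\<dots> \<le> s * ((\<Sum>p\<in>(UNIV :: 'i set). c) + L2_set a UNIV)"
    using assms by (intro mult_left_mono add_right_mono L2_set_le_sum) auto
  finally show ?thesis by (simp add: L2_set_def)
qed

lemma sum_square_offdiag:
  fixes A :: "'d::finite \<Rightarrow> real^'n^'n"
  shows "(\<Sum>k\<in>UNIV. (norm (offdiag (A k)))\<^sup>2) =
    (\<Sum>p\<in>UNIV. (norm (if fst p = snd p then 0 else \<chi> k. A k $ fst p $ snd p))\<^sup>2)"
proof -
  have "(\<Sum>k\<in>UNIV. (norm (offdiag (A k)))\<^sup>2) =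
      (\<Sum>k\<in>UNIV. \<Sum>p\<in>UNIV. (if fst p = snd p then 0 else (A k $ fst p $ snd p)\<^sup>2))"
    by (intro sum.cong refl)
       (auto simp: power2_norm_matrix offdiag_def sum.cartesian_product intro!: sum.cong)
  also have "\<dots> = (\<Sum>p\<in>UNIV. \<Sum>k\<in>UNIV. (if fst p = snd p then 0 else (A k $ fst p $ snd p)\<^sup>2))"
    by (rule sum.swap)
  also have "\<dots> = (\<Sum>p\<in>UNIV. (norm (if fst p = snd p then 0 else \<chi> k. A k $ fst p $ snd p))\<^sup>2)"
    by (intro sum.cong refl) (simp add: norm_vec_def L2_set_def sum_nonneg)
  finally show ?thesis .
qed

lemma sum_square_entries:
  fixes A :: "'d::finite \<Rightarrow> real^'n^'n"
  shows "(\<Sum>p\<in>UNIV. (norm (\<chi> k. A k $ fst p $ snd p))\<^sup>2) = (\<Sum>k\<in>UNIV. (norm (A k))\<^sup>2)"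
proof -
  have "(\<Sum>p\<in>UNIV. (norm (\<chi> k. A k $ fst p $ snd p))\<^sup>2) =
      (\<Sum>p\<in>UNIV. \<Sum>k\<in>UNIV. (A k $ fst p $ snd p)\<^sup>2)"
    by (intro sum.cong refl) (simp add: norm_vec_def L2_set_def sum_nonneg)
  also have "\<dots> = (\<Sum>k\<in>UNIV. \<Sum>p\<in>UNIV. (A k $ fst p $ snd p)\<^sup>2)"
    by (rule sum.swap)
  also have "\<dots> = (\<Sum>k\<in>UNIV. (norm (A k))\<^sup>2)"
    by (intro sum.cong refl) (simp add: power2_norm_matrix sum.cartesian_product case_prod_beta)
  finally show ?thesis .
qed

text \<open>For \<open>i \<noteq> j\<close> the indices \<open>l\<close> with \<open>\<Lambda> l\<close> outside \<open>{\<gamma> i, \<gamma> j}\<close> contribute to \<open>q\<close> a product of two coordinates that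
  are both \<open>O(\<epsilon>)\<close>, hence a remainder of second order, and \<open>well_conditioned_error\<close> applies with the
  projection for \<open>\<gamma> i\<close> and \<open>\<gamma> j\<close>. This also covers \<open>\<gamma> i = \<gamma> j\<close>.\<close>

lemma first_order_bound_well_conditioned:
  fixes A E :: "'d::finite \<Rightarrow> real^'n^'n" and \<Lambda> :: "'n \<Rightarrow> real^'d" and X0 :: "real^'n^'n"
  assumes \<delta>: "\<And>l. \<delta> l \<noteq> 0" and X0: "invertible X0"
    and diag: "\<And>k i j. congr X0 (A k) $ i $ j = (if i = j then \<delta> i * \<Lambda> i $ k else 0)"
    and E: "(\<Sum>k\<in>UNIV. (frob_norm (E k))\<^sup>2) = 1"
    and wc: "well_conditioned (range \<Lambda>) \<theta> \<mu> r" and "r \<ge> 0"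
  shows "first_order_bound A E (r + 1) \<theta> \<mu>"
proof -
  obtain C where "C \<ge> 0" and C: "\<And>\<epsilon> X i. \<epsilon> > 0 \<Longrightarrow> invertible X \<Longrightarrow>
       is_diagonal (congr X (lin_comb (perturb A E \<epsilon>) \<mu>)) \<Longrightarrow>
       is_diagonal (congr X (lin_comb (perturb A E \<epsilon>) \<theta>)) \<Longrightarrow>
       \<exists>g\<in>range \<Lambda>. \<forall>l. \<Lambda> l \<noteq> g \<longrightarrow>
         \<bar>(matrix_inv X0 *v column i X) $ l\<bar> \<le> C * \<epsilon> * spectral_norm X"
    using eigenvector_localization[OF \<delta> X0 diag wc] by metis
  define B where "B = C\<^sup>2 * (\<Sum>l\<in>UNIV. \<bar>\<delta> l\<bar> * norm (\<Lambda> l))"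
  define n2 where "n2 = real CARD('n \<times> 'n)"
  have "B \<ge> 0" by (simp add: B_def sum_nonneg)
  have main: "offdiag_error (perturb A E \<epsilon>) X \<le> (r + 1) * \<epsilon> + (r + 1) * n2 * B * \<epsilon>\<^sup>2"
    if \<epsilon>: "\<epsilon> > 0" and X: "invertible X"
      "is_diagonal (congr X (lin_comb (perturb A E \<epsilon>) \<mu>))"
      "is_diagonal (congr X (lin_comb (perturb A E \<epsilon>) \<theta>))" for \<epsilon> and X :: "real^'n^'n"
  proof -
    define N where "N = spectral_norm X"
    have "N \<ge> 0" by (simp add: N_def spectral_norm_nonneg)
    obtain \<gamma> where \<gamma>: "\<And>i. \<gamma> i \<in> range \<Lambda>" and small:
      "\<And>i l. \<Lambda> l \<noteq> \<gamma> i \<Longrightarrow> \<bar>(matrix_inv X0 *v column i X) $ l\<bar> \<le> C * \<epsilon> * N"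
      using C[OF \<epsilon> X] unfolding N_def by metis
    define e where "e p = (\<chi> k. congr X (E k) $ fst p $ snd p)" for p :: "'n \<times> 'n"
    define w where "w p = (\<chi> k. congr X (perturb A E \<epsilon> k) $ fst p $ snd p)" for p :: "'n \<times> 'n"
    have w: "norm (w p) \<le> (r + 1) * (B * (\<epsilon> * N)\<^sup>2 + \<epsilon> * norm (e p))" if "fst p \<noteq> snd p" for p
    proof -
      define i j where "i = fst p" and "j = snd p"
      have "i \<noteq> j" using that by (simp add: i_def j_def)
      define z where "z i = matrix_inv X0 *v column i X" for i
      define I where "I = {l. \<Lambda> l \<in> {\<gamma> i, \<gamma> j}}"
      define q where "q = (\<chi> k. column i X \<bullet> (A k *v column j X))"
      define c where "c l = \<delta> l * z i $ l * z j $ l" for l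
      define s where "s = (\<Sum>l\<in>-I. c l *\<^sub>R \<Lambda> l)"
      have q: "q = (\<Sum>l\<in>I. c l *\<^sub>R \<Lambda> l) + s"
      proof -
        have "q = (\<Sum>l\<in>UNIV. c l *\<^sub>R \<Lambda> l)"
          unfolding q_def congr_form[OF X0 diag] by (simp add: c_def z_def)
        also have "\<dots> = (\<Sum>l\<in>I. c l *\<^sub>R \<Lambda> l) + s"
          unfolding s_def by (subst sum.union_disjoint[symmetric]) auto
        finally show ?thesis .
      qed
      have "norm s \<le> (\<Sum>l\<in>-I. norm (c l *\<^sub>R \<Lambda> l))"
        unfolding s_def by (rule norm_sum)
      also have "\<dots> \<le> (\<Sum>l\<in>-I. (C * \<epsilon> * N)\<^sup>2 * (\<bar>\<delta> l\<bar> * norm (\<Lambda> l)))"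
      proof (rule sum_mono)
        fix l assume "l \<in> - I"
        then have "\<bar>z i $ l\<bar> * \<bar>z j $ l\<bar> \<le> (C * \<epsilon> * N) * (C * \<epsilon> * N)"
          using small[of l i] small[of l j] by (intro mult_mono) (auto simp: I_def z_def intro: order_trans)
        then have "(\<bar>z i $ l\<bar> * \<bar>z j $ l\<bar>) * (\<bar>\<delta> l\<bar> * norm (\<Lambda> l)) \<le>
            (C * \<epsilon> * N)\<^sup>2 * (\<bar>\<delta> l\<bar> * norm (\<Lambda> l))"
          unfolding power2_eq_square by (intro mult_right_mono) auto
        then show "norm (c l *\<^sub>R \<Lambda> l) \<le> (C * \<epsilon> * N)\<^sup>2 * (\<bar>\<delta> l\<bar> * norm (\<Lambda> l))"
          by (simp add: c_def abs_mult mult_ac)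
      qed
      also have "\<dots> \<le> (\<Sum>l\<in>UNIV. (C * \<epsilon> * N)\<^sup>2 * (\<bar>\<delta> l\<bar> * norm (\<Lambda> l)))"
        by (intro sum_mono2) auto
      also have "\<dots> = B * (\<epsilon> * N)\<^sup>2"
        by (simp add: B_def sum_distrib_left sum_distrib_right power_mult_distrib mult_ac)
      finally have s: "norm s \<le> B * (\<epsilon> * N)\<^sup>2" .
      have e: "e p = (\<chi> k. column i X \<bullet> (E k *v column j X))"
        by (simp add: e_def i_def j_def congr_entry)
      have wq: "w p = q + \<epsilon> *\<^sub>R e p"
        by (simp add: w_def q_def e i_def j_def congr_entry perturb_def vec_eq_iff
            matrix_vector_mult_add_rdistrib inner_add_right scaleR_matrix_vector_assoc[symmetric])
      have orth: "\<nu> \<bullet> w p = 0" if "is_diagonal (congr X (lin_comb (perturb A E \<epsilon>) \<nu>))" for \<nu>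
      proof -
        have "\<nu> \<bullet> w p = congr X (lin_comb (perturb A E \<epsilon>) \<nu>) $ i $ j"
          by (simp add: w_def i_def j_def congr_entry inner_lin_comb)
        then show ?thesis using that \<open>i \<noteq> j\<close> by (simp add: is_diagonal_def)
      qed
      have "norm (w p) \<le> (r + 1) * (norm s + norm (\<epsilon> *\<^sub>R e p))"
        unfolding wq using orth X unfolding wq
        by (intro well_conditioned_error[OF wc \<gamma>[of i] \<gamma>[of j] _ _ q]) (auto simp: I_def)
      also have "\<dots> \<le> (r + 1) * (B * (\<epsilon> * N)\<^sup>2 + \<epsilon> * norm (e p))"
        using s \<epsilon> \<open>r \<ge> 0\<close> by (intro mult_left_mono) auto
      finally show ?thesis .
    qed
    define f where "f p = norm (if fst p = snd p then 0 else w p)" for p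
    \<comment> \<open>The first order term: over all entries, the perturbation has norm at most \<open>N\<^sup>2\<close>, as the family \<open>E\<close> is normalized.\<close>
    have E_sum: "sqrt (\<Sum>p\<in>UNIV. (\<epsilon> * norm (e p))\<^sup>2) \<le> \<epsilon> * N\<^sup>2"
    proof -
      have "(\<Sum>p\<in>UNIV. (\<epsilon> * norm (e p))\<^sup>2) = \<epsilon>\<^sup>2 * (\<Sum>k\<in>UNIV. (norm (congr X (E k)))\<^sup>2)"
        unfolding e_def sum_square_entries[symmetric] by (simp add: power_mult_distrib sum_distrib_left)
      also have "\<dots> \<le> \<epsilon>\<^sup>2 * (\<Sum>k\<in>UNIV. (N\<^sup>2 * norm (E k))\<^sup>2)"
        unfolding N_def by (intro mult_left_mono sum_mono power_mono norm_congr_le) auto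
      also have "\<dots> = \<epsilon>\<^sup>2 * ((N\<^sup>2)\<^sup>2 * (\<Sum>k\<in>UNIV. (norm (E k))\<^sup>2))"
        by (simp add: power_mult_distrib sum_distrib_left)
      also have "\<dots> = (\<epsilon> * N\<^sup>2)\<^sup>2"
        by (simp add: E power_mult_distrib)
      finally show ?thesis
        using \<epsilon> by (intro real_le_lsqrt) (auto simp: sum_nonneg)
    qed
    have "sqrt (\<Sum>k\<in>UNIV. (norm (offdiag (congr X (perturb A E \<epsilon> k))))\<^sup>2) = sqrt (\<Sum>p\<in>UNIV. (f p)\<^sup>2)"
      unfolding sum_square_offdiag f_def w_def ..
    also have "\<dots> \<le> (r + 1) * (n2 * (B * (\<epsilon> * N)\<^sup>2) + sqrt (\<Sum>p\<in>UNIV. (\<epsilon> * norm (e p))\<^sup>2))"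
      unfolding n2_def
    proof (rule sqrt_sum_square_le)
      fix p
      show "f p \<le> (r + 1) * (B * (\<epsilon> * N)\<^sup>2 + \<epsilon> * norm (e p))"
        using w[of p] \<open>B \<ge> 0\<close> \<epsilon> \<open>r \<ge> 0\<close> by (auto simp: f_def)
    qed (use \<open>B \<ge> 0\<close> \<epsilon> \<open>r \<ge> 0\<close> in \<open>auto simp: f_def\<close>)
    also have "\<dots> \<le> (r + 1) * (n2 * (B * (\<epsilon> * N)\<^sup>2) + \<epsilon> * N\<^sup>2)"
      using E_sum \<open>r \<ge> 0\<close> by (intro mult_left_mono add_left_mono) auto
    also have "\<dots> = N\<^sup>2 * ((r + 1) * \<epsilon> + (r + 1) * n2 * B * \<epsilon>\<^sup>2)"
      by (simp add: power_mult_distrib algebra_simps)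
    finally have le: "sqrt (\<Sum>k\<in>UNIV. (norm (offdiag (congr X (perturb A E \<epsilon> k))))\<^sup>2) \<le>
      N\<^sup>2 * ((r + 1) * \<epsilon> + (r + 1) * n2 * B * \<epsilon>\<^sup>2)" .
    show ?thesis
    proof (cases "N = 0")
      case True
      then show ?thesis
        using \<epsilon> \<open>r \<ge> 0\<close> \<open>B \<ge> 0\<close> by (simp add: offdiag_error_def N_def n2_def)
    next
      case False
      then show ?thesis
        using le \<open>N \<ge> 0\<close> by (simp add: offdiag_error_def N_def[symmetric] divide_le_eq mult.commute)
    qed
  qed
  show ?thesis
    unfolding first_order_bound_def
    by (intro exI[of _ "(r + 1) * n2 * B"]) (use main in \<open>auto simp: eventually_at_right_field intro: gt_ex\<close>)
qed

section \<open>Standard Gaussian vectors\<close>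

lemma borel_measurable_vec_component:
  fixes f :: "'a \<Rightarrow> real^'d::finite"
  assumes [measurable]: "f \<in> borel_measurable M"
  shows "(\<lambda>\<omega>. f \<omega> $ j) \<in> borel_measurable M"
  unfolding cart_eq_inner_axis by measurable

text \<open>Lebesgue measure on a Euclidean space is a product over its basis; this lemma translates
  to products over the coordinates.\<close>

lemma prod_Basis_vec:
  fixes f :: "'d::finite \<Rightarrow> 'a::comm_monoid_mult"
  shows "(\<Prod>k\<in>UNIV. f k) = (\<Prod>b\<in>(Basis::(real^'d) set). f (axis_index b))"
proof -
  have inj: "inj (\<lambda>k. axis k 1 :: real^'d)"
    by (auto simp: inj_def axis_eq_axis)
  have B: "(Basis::(real^'d) set) = range (\<lambda>k. axis k 1)"
    by (auto simp: Basis_vec_def)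
  show ?thesis
    unfolding B by (subst prod.reindex[OF inj]) (simp add: axis_index_axis)
qed

context prob_space
begin

lemma prob_std_gaussian_box:
  fixes \<theta> :: "'a \<Rightarrow> real^'d::finite"
  assumes \<theta>: "distributed M lborel \<theta> std_gaussian_density"
    and A: "\<And>k. A k \<in> sets borel"
  shows "emeasure M {\<omega>\<in>space M. \<forall>k. \<theta> \<omega> $ k \<in> A k} =
    (\<Prod>k\<in>UNIV. \<integral>\<^sup>+x. ennreal (std_normal_density x) * indicator (A k) x \<partial>lborel)"
proof -
  note [measurable] = A
  let ?f = "\<lambda>b x. ennreal (std_normal_density x) * indicator (A (axis_index b)) x"
  have B: "{x :: real^'d. \<forall>k. x $ k \<in> A k} \<in> sets lborel"
    by measurable
  have "emeasure M {\<omega>\<in>space M. \<forall>k. \<theta> \<omega> $ k \<in> A k} =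
      emeasure M (\<theta> -` {x. \<forall>k. x $ k \<in> A k} \<inter> space M)"
    by (intro arg_cong[where f="emeasure M"]) auto
  also have "\<dots> = (\<integral>\<^sup>+x. ennreal (std_gaussian_density x) *
      indicator {x. \<forall>k. x $ k \<in> A k} x \<partial>lborel)"
    by (rule distributed_emeasure[OF \<theta> B])
  also have "\<dots> = (\<integral>\<^sup>+x. (\<Prod>b\<in>(Basis::(real^'d) set). ?f b (x \<bullet> b)) \<partial>lborel)"
  proof (intro nn_integral_cong)
    fix x :: "real^'d"
    have "ennreal (std_gaussian_density x) * indicator {x. \<forall>k. x $ k \<in> A k} x =
      (\<Prod>k\<in>UNIV. ennreal (std_normal_density (x $ k)) * indicator (A k) (x $ k))"
      by (auto simp: std_gaussian_density_def prod.distrib prod_ennreal indicator_def)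
    also have "\<dots> = (\<Prod>b\<in>(Basis::(real^'d) set). ?f b (x $ axis_index b))"
      by (rule prod_Basis_vec)
    also have "\<dots> = (\<Prod>b\<in>Basis. ?f b (x \<bullet> b))"
      by (intro prod.cong) (auto simp: Basis_vec_def axis_index_axis inner_axis)
    finally show "ennreal (std_gaussian_density x) * indicator {x. \<forall>k. x $ k \<in> A k} x =
      (\<Prod>b\<in>Basis. ?f b (x \<bullet> b))" .
  qed
  also have "\<dots> = (\<Prod>b\<in>(Basis::(real^'d) set). \<integral>\<^sup>+x. ?f b x \<partial>lborel)"
    by (rule nn_integral_lborel_prod) auto
  also have "\<dots> = (\<Prod>k\<in>UNIV. \<integral>\<^sup>+x. ennreal (std_normal_density x) * indicator (A k) x \<partial>lborel)"
    by (rule prod_Basis_vec[symmetric])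
  finally show ?thesis .
qed

lemma nn_integral_std_normal_density: "(\<integral>\<^sup>+x. ennreal (std_normal_density x) \<partial>lborel) = 1"
  using prob_space.emeasure_space_1[OF prob_space_normal_density[of 1 0]]
  by (simp add: emeasure_density)

lemma distributed_std_gaussian_component:
  fixes \<theta> :: "'a \<Rightarrow> real^'d::finite"
  assumes \<theta>: "distributed M lborel \<theta> std_gaussian_density"
  shows "distributed M lborel (\<lambda>\<omega>. \<theta> \<omega> $ k) std_normal_density"
proof -
  have [measurable]: "\<theta> \<in> borel_measurable M"
    using distributed_measurable[OF \<theta>] by simp
  have comp [measurable]: "(\<lambda>\<omega>. \<theta> \<omega> $ j) \<in> borel_measurable M" for j
    by (rule borel_measurable_vec_component) measurable
  show ?thesis
    unfolding distributed_def
  proof safe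
    show "distr M lborel (\<lambda>\<omega>. \<theta> \<omega> $ k) = density lborel (\<lambda>x. ennreal (std_normal_density x))"
    proof (rule measure_eqI)
      fix B :: "real set" assume "B \<in> sets (distr M lborel (\<lambda>\<omega>. \<theta> \<omega> $ k))"
      then have [measurable]: "B \<in> sets borel" by simp
      \<comment> \<open>A marginal probability is that of a box which is unbounded in the other coordinates.\<close>
      let ?A = "\<lambda>j. if j = k then B else UNIV"
      have "emeasure (distr M lborel (\<lambda>\<omega>. \<theta> \<omega> $ k)) B =
          emeasure M {\<omega>\<in>space M. \<forall>j. \<theta> \<omega> $ j \<in> ?A j}"
        by (subst emeasure_distr) (auto intro!: arg_cong[where f="emeasure M"] split: if_splits)
      also have "\<dots> = (\<Prod>j\<in>UNIV. \<integral>\<^sup>+x. ennreal (std_normal_density x) * indicator (?A j) x \<partial>lborel)"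
        by (rule prob_std_gaussian_box[OF \<theta>]) auto
      also have "\<dots> = (\<Prod>j\<in>UNIV. if j = k then
          \<integral>\<^sup>+x. ennreal (std_normal_density x) * indicator B x \<partial>lborel else 1)"
        by (intro prod.cong) (auto simp: nn_integral_std_normal_density)
      also have "\<dots> = emeasure (density lborel (\<lambda>x. ennreal (std_normal_density x))) B"
        by (simp add: emeasure_density)
      finally show "emeasure (distr M lborel (\<lambda>\<omega>. \<theta> \<omega> $ k)) B =
        emeasure (density lborel (\<lambda>x. ennreal (std_normal_density x))) B" .
    qed simp
  qed auto
qed

lemma indep_std_gaussian_components:
  fixes \<theta> :: "'a \<Rightarrow> real^'d::finite"
  assumes \<theta>: "distributed M lborel \<theta> std_gaussian_density"
  shows "indep_vars (\<lambda>_. borel) (\<lambda>k \<omega>. \<theta> \<omega> $ k) UNIV"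
proof -
  have [measurable]: "\<theta> \<in> borel_measurable M"
    using distributed_measurable[OF \<theta>] by simp
  have comp [measurable]: "(\<lambda>\<omega>. \<theta> \<omega> $ j) \<in> borel_measurable M" for j
    by (rule borel_measurable_vec_component) measurable
  have D: "emeasure (distr M borel (\<lambda>\<omega>. \<theta> \<omega> $ k)) B =
      (\<integral>\<^sup>+x. ennreal (std_normal_density x) * indicator B x \<partial>lborel)" if "B \<in> sets borel" for k B
    using distributed_emeasure[OF distributed_std_gaussian_component[OF \<theta>, of k], of B] that
    by (subst emeasure_distr) auto
  interpret product_sigma_finite "\<lambda>k. distr M borel (\<lambda>\<omega>. \<theta> \<omega> $ k)"
    by (intro product_sigma_finite.intro prob_space_imp_sigma_finite prob_space_distr) simp
  have "distr M (\<Pi>\<^sub>M k\<in>UNIV. borel) (\<lambda>\<omega>. \<lambda>k\<in>UNIV. \<theta> \<omega> $ k) =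
      (\<Pi>\<^sub>M k\<in>UNIV. distr M borel (\<lambda>\<omega>. \<theta> \<omega> $ k))"
  proof (rule PiM_eqI)
    fix A :: "'d \<Rightarrow> real set"
    assume "\<And>k. k \<in> UNIV \<Longrightarrow> A k \<in> sets (distr M borel (\<lambda>\<omega>. \<theta> \<omega> $ k))"
    then have A [measurable]: "\<And>k. A k \<in> sets borel" by simp
    have P: "Pi\<^sub>E UNIV A \<in> sets (\<Pi>\<^sub>M k\<in>(UNIV::'d set). borel)"
      by (rule sets_PiM_I_finite) auto
    have "emeasure (distr M (\<Pi>\<^sub>M k\<in>UNIV. borel) (\<lambda>\<omega>. \<lambda>k\<in>UNIV. \<theta> \<omega> $ k)) (Pi\<^sub>E UNIV A) =
        emeasure M {\<omega>\<in>space M. \<forall>j. \<theta> \<omega> $ j \<in> A j}"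
      by (subst emeasure_distr[OF _ P])
         (measurable, auto intro!: arg_cong[where f="emeasure M"])
    also have "\<dots> = (\<Prod>k\<in>UNIV. emeasure (distr M borel (\<lambda>\<omega>. \<theta> \<omega> $ k)) (A k))"
      by (simp add: prob_std_gaussian_box[OF \<theta> A] D)
    finally show "emeasure (distr M (\<Pi>\<^sub>M k\<in>UNIV. borel) (\<lambda>\<omega>. \<lambda>k\<in>UNIV. \<theta> \<omega> $ k)) (Pi\<^sub>E UNIV A) =
      (\<Prod>k\<in>UNIV. emeasure (distr M borel (\<lambda>\<omega>. \<theta> \<omega> $ k)) (A k))" .
  qed (auto intro!: sets_PiM_cong)
  then show ?thesis
    by (subst indep_vars_iff_distr_eq_PiM) auto
qed

text \<open>Rotation invariance in the only form needed: a sum of independent normal variables is normal,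
  with variance the squared norm of \<open>u\<close>.\<close>

lemma distributed_std_gaussian_inner:
  fixes \<theta> :: "'a \<Rightarrow> real^'d::finite"
  assumes \<theta>: "distributed M lborel \<theta> std_gaussian_density" and u: "norm u = 1"
  shows "distributed M lborel (\<lambda>\<omega>. \<theta> \<omega> \<bullet> u) std_normal_density"
proof -
  \<comment> \<open>Vanishing coefficients are left out, since a normal density requires a positive deviation.\<close>
  define I where "I = {k. u $ k \<noteq> 0}"
  have "u \<noteq> 0" using u by auto
  then have "I \<noteq> {}" by (auto simp: I_def vec_eq_iff)
  have "(\<Sum>k\<in>I. (u $ k)\<^sup>2) = (\<Sum>k\<in>UNIV. (u $ k)\<^sup>2)"
    by (rule sum.mono_neutral_left) (auto simp: I_def)
  also have "\<dots> = u \<bullet> u"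
    by (simp add: inner_vec_def power2_eq_square)
  also have "\<dots> = 1" using u by (simp add: norm_eq_1)
  finally have s: "(\<Sum>k\<in>I. \<bar>u $ k\<bar>\<^sup>2) = 1" by simp
  have ind: "indep_vars (\<lambda>_. borel) (\<lambda>k \<omega>. u $ k * \<theta> \<omega> $ k) I"
    by (rule indep_vars_compose2[OF indep_vars_subset[OF indep_std_gaussian_components[OF \<theta>]]]) auto
  have "distributed M lborel (\<lambda>\<omega>. u $ k * \<theta> \<omega> $ k) (normal_density 0 \<bar>u $ k\<bar>)" if "k \<in> I" for k
    using normal_density_affine[OF distributed_std_gaussian_component[OF \<theta>, of k], of "u $ k" 0] that
    by (simp add: I_def)
  from sum_indep_normal[OF _ \<open>I \<noteq> {}\<close> ind _ this]
  have "distributed M lborel (\<lambda>\<omega>. \<Sum>k\<in>I. u $ k * \<theta> \<omega> $ k) std_normal_density"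
    using s by (simp add: I_def)
  also have "(\<lambda>\<omega>. \<Sum>k\<in>I. u $ k * \<theta> \<omega> $ k) = (\<lambda>\<omega>. \<theta> \<omega> \<bullet> u)"
    unfolding inner_vec_def by (auto simp: I_def fun_eq_iff mult.commute intro!: sum.mono_neutral_left)
  finally show ?thesis .
qed

lemma std_normal_small_ball:
  assumes Z: "distributed M lborel Z std_normal_density" and "\<tau> \<ge> 0"
  shows "emeasure M {\<omega>\<in>space M. \<bar>Z \<omega>\<bar> \<le> \<tau>} \<le> ennreal (sqrt (2 / pi) * \<tau>)"
proof -
  have "emeasure M {\<omega>\<in>space M. \<bar>Z \<omega>\<bar> \<le> \<tau>} = emeasure M (Z -` {-\<tau>..\<tau>} \<inter> space M)"
    by (intro arg_cong[where f="emeasure M"]) auto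
  also have "\<dots> = (\<integral>\<^sup>+x. ennreal (std_normal_density x) * indicator {-\<tau>..\<tau>} x \<partial>lborel)"
    by (rule distributed_emeasure[OF Z]) simp
  also have "\<dots> \<le> (\<integral>\<^sup>+x. ennreal (1 / sqrt (2 * pi)) * indicator {-\<tau>..\<tau>} x \<partial>lborel)"
    by (intro nn_integral_mono)
       (auto simp: std_normal_density_def indicator_def intro!: ennreal_leI divide_right_mono)
  also have "\<dots> = ennreal (1 / sqrt (2 * pi) * (2 * \<tau>))"
    using \<open>\<tau> \<ge> 0\<close> by (subst nn_integral_cmult_indicator) (auto simp flip: ennreal_mult)
  also have "1 / sqrt (2 * pi) * (2 * \<tau>) = sqrt (2 / pi) * \<tau>"
    by (simp add: real_sqrt_mult real_sqrt_divide field_simps)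
  finally show ?thesis .
qed

text \<open>Conditioning on \<open>\<mu>\<close> fixes the direction \<open>v (\<mu> \<omega>)\<close> without changing the law of \<open>\<theta>\<close>; by Fubini the bound for a
  fixed unit vector carries over.\<close>

lemma std_gaussian_random_direction_small_ball:
  fixes \<theta> \<mu> :: "'a \<Rightarrow> real^'d::finite"
  assumes \<theta>: "distributed M lborel \<theta> std_gaussian_density"
    and indep: "indep_var borel \<theta> borel \<mu>"
    and v [measurable]: "v \<in> borel_measurable borel" and unit: "\<And>x. norm (v x) = 1"
    and "\<tau> \<ge> 0"
  shows "prob {\<omega>\<in>space M. \<bar>\<theta> \<omega> \<bullet> v (\<mu> \<omega>)\<bar> \<le> \<tau>} \<le> sqrt (2 / pi) * \<tau>"
proof -
  have [measurable]: "\<theta> \<in> borel_measurable M" "\<mu> \<in> borel_measurable M"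
    using indep_var_rv1[OF indep] indep_var_rv2[OF indep] by auto
  interpret T: prob_space "distr M borel \<theta>" by (rule prob_space_distr) simp
  interpret U: prob_space "distr M borel \<mu>" by (rule prob_space_distr) simp
  interpret TU: pair_prob_space "distr M borel \<theta>" "distr M borel \<mu>" ..
  let ?Q = "{p\<in>space (borel \<Otimes>\<^sub>M borel). \<bar>fst p \<bullet> v (snd p)\<bar> \<le> \<tau>}"
  have Q: "?Q \<in> sets (borel \<Otimes>\<^sub>M borel)" by measurable
  have Q': "?Q \<in> sets (distr M borel \<theta> \<Otimes>\<^sub>M distr M borel \<mu>)"
    using Q by simp
  have "emeasure M {\<omega>\<in>space M. \<bar>\<theta> \<omega> \<bullet> v (\<mu> \<omega>)\<bar> \<le> \<tau>} =
      emeasure (distr M (borel \<Otimes>\<^sub>M borel) (\<lambda>\<omega>. (\<theta> \<omega>, \<mu> \<omega>))) ?Q"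
    by (subst emeasure_distr[OF _ Q])
       (measurable, auto intro!: arg_cong[where f="emeasure M"] simp: space_pair_measure)
  also have "distr M (borel \<Otimes>\<^sub>M borel) (\<lambda>\<omega>. (\<theta> \<omega>, \<mu> \<omega>)) = distr M borel \<theta> \<Otimes>\<^sub>M distr M borel \<mu>"
    using indep by (simp add: indep_var_distribution_eq)
  also have "emeasure \<dots> ?Q = (\<integral>\<^sup>+y. emeasure (distr M borel \<theta>) ((\<lambda>x. (x, y)) -` ?Q) \<partial>distr M borel \<mu>)"
    by (rule TU.emeasure_pair_measure_alt2[OF Q'])
  also have "\<dots> \<le> (\<integral>\<^sup>+y. ennreal (sqrt (2 / pi) * \<tau>) \<partial>distr M borel \<mu>)"
  proof (rule nn_integral_mono)
    fix y :: "real^'d"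
    have "emeasure (distr M borel \<theta>) ((\<lambda>x. (x, y)) -` ?Q) =
        emeasure M {\<omega>\<in>space M. \<bar>\<theta> \<omega> \<bullet> v y\<bar> \<le> \<tau>}"
      by (subst emeasure_distr)
         (auto intro!: arg_cong[where f="emeasure M"] simp: space_pair_measure)
    also have "\<dots> \<le> ennreal (sqrt (2 / pi) * \<tau>)"
      by (rule std_normal_small_ball[OF distributed_std_gaussian_inner[OF \<theta> unit] \<open>\<tau> \<ge> 0\<close>])
    finally show "emeasure (distr M borel \<theta>) ((\<lambda>x. (x, y)) -` ?Q) \<le> ennreal (sqrt (2 / pi) * \<tau>)" .
  qed
  also have "\<dots> = ennreal (sqrt (2 / pi) * \<tau>)"
    by (simp add: U.emeasure_space_1[simplified])
  finally show ?thesis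
    using \<open>\<tau> \<ge> 0\<close> by (simp add: emeasure_eq_measure)
qed

text \<open>Markov's inequality: the squared norms have expectation \<open>CARD('d)\<close> each.\<close>

lemma std_gaussian_norm_tail:
  fixes \<theta> \<mu> :: "'a \<Rightarrow> real^'d::finite"
  assumes \<theta>: "distributed M lborel \<theta> std_gaussian_density"
    and \<mu>: "distributed M lborel \<mu> std_gaussian_density" and "c > 0"
  shows "prob {\<omega>\<in>space M. (norm (\<theta> \<omega>))\<^sup>2 + (norm (\<mu> \<omega>))\<^sup>2 \<ge> c} \<le> 2 * real CARD('d) / c"
proof -
  have comp: "integrable M (\<lambda>\<omega>. (\<nu> \<omega> $ k)\<^sup>2) \<and> expectation (\<lambda>\<omega>. (\<nu> \<omega> $ k)\<^sup>2) = 1"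
    if \<nu>: "distributed M lborel \<nu> std_gaussian_density" for \<nu> :: "'a \<Rightarrow> real^'d" and k
  proof -
    note D = distributed_std_gaussian_component[OF \<nu>, of k]
    have "integrable lborel (\<lambda>x. std_normal_density x * x\<^sup>2)"
      by (rule integrable_std_normal_moment)
    moreover have "expectation (\<lambda>\<omega>. (\<nu> \<omega> $ k)\<^sup>2) = 1"
      using integral_std_normal_moment_even[of 1] distributed_integral[OF D, of "\<lambda>x. x\<^sup>2"] by simp
    ultimately show ?thesis
      using distributed_integrable[OF D, of "\<lambda>x. x\<^sup>2"] by simp
  qed
  have eq: "(norm (\<nu> \<omega>))\<^sup>2 = (\<Sum>k\<in>UNIV. (\<nu> \<omega> $ k)\<^sup>2)" for \<nu> :: "'a \<Rightarrow> real^'d" and \<omega>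
    unfolding power2_norm_eq_inner inner_vec_def by (simp add: power2_eq_square)
  have "integrable M (\<lambda>\<omega>. (norm (\<theta> \<omega>))\<^sup>2 + (norm (\<mu> \<omega>))\<^sup>2)"
    unfolding eq using comp[OF \<theta>] comp[OF \<mu>] by (intro Bochner_Integration.integrable_add Bochner_Integration.integrable_sum) auto
  moreover have "expectation (\<lambda>\<omega>. (norm (\<theta> \<omega>))\<^sup>2 + (norm (\<mu> \<omega>))\<^sup>2) = 2 * real CARD('d)"
    unfolding eq using comp[OF \<theta>] comp[OF \<mu>] by (simp add: Bochner_Integration.integral_sum)
  ultimately show ?thesis
    using integral_Markov_inequality_measure[of M "\<lambda>\<omega>. (norm (\<theta> \<omega>))\<^sup>2 + (norm (\<mu> \<omega>))\<^sup>2" "space M" c] \<open>c > 0\<close>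
    by simp
qed

end

section \<open>Probability of well-conditioned coefficient vectors\<close>

text \<open>The left side counts the events in the union bound: one for each eigenvalue vector and two
  for each ordered pair of distinct ones. The cube matches the power of \<open>m\<close> in the square of the final bound.\<close>

lemma two_square_minus_self_le_cube:
  "real m + 2 * (real m * (real m - 1)) \<le> real m ^ 3"
proof -
  have "real m ^ 3 - (real m + 2 * (real m * (real m - 1))) = real m * (real m - 1)\<^sup>2"
    by (simp add: power3_eq_cube power2_eq_square algebra_simps)
  also have "\<dots> \<ge> 0" by simp
  finally show ?thesis by simp
qed

context prob_space
begin

lemma indep_var_swap:
  assumes "indep_var A X B Y"
  shows "indep_var B Y A X"
  using assms unfolding indep_var_eq indep_sets2_eq
  by (metis (no_types, lifting) Int_commute mult.commute)

text \<open>The exceptional events are that the norms of \<open>\<theta>\<close> and \<open>\<mu>\<close> are too large, or that one of the inner products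
  required to be larger than \<open>\<tau>\<close> in \<open>well_conditionedI\<close> is not.\<close>

lemma std_gaussian_well_conditioned:
  fixes \<theta> \<mu> :: "'a \<Rightarrow> real^'d::finite"
  assumes \<theta>: "distributed M lborel \<theta> std_gaussian_density"
    and \<mu>: "distributed M lborel \<mu> std_gaussian_density"
    and indep: "indep_var borel \<theta> borel \<mu>"
    and "finite V" and t: "\<And>g. g \<in> V \<Longrightarrow> t \<bullet> g = 1" and "\<tau> > 0" "c > 0"
  shows "\<exists>S\<in>sets M. (\<forall>\<omega>\<in>S. well_conditioned V (\<theta> \<omega>) (\<mu> \<omega>) (sqrt 2 * c / \<tau>)) \<and>
    measure M S \<ge> 1 - (2 * real CARD('d) / c\<^sup>2 + real (card V) ^ 3 * (sqrt (2 / pi) * \<tau>))"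
proof -
  have [measurable]: "\<theta> \<in> borel_measurable M" "\<mu> \<in> borel_measurable M"
    using indep_var_rv1[OF indep] indep_var_rv2[OF indep] by auto
  let ?v = orthogonal_direction and ?s = "sqrt (2 / pi) * \<tau>" and ?m = "real (card V)"
  define N where "N = {\<omega>\<in>space M. (norm (\<theta> \<omega>))\<^sup>2 + (norm (\<mu> \<omega>))\<^sup>2 \<ge> c\<^sup>2}"
  define B1 where "B1 g = {\<omega>\<in>space M. \<bar>\<mu> \<omega> \<bullet> sgn g\<bar> \<le> \<tau>}" for g
  define B2 where "B2 g h = {\<omega>\<in>space M. \<bar>\<theta> \<omega> \<bullet> ?v g h (\<mu> \<omega>)\<bar> \<le> \<tau>}" for g h
  define B3 where "B3 g h = {\<omega>\<in>space M. \<bar>\<mu> \<omega> \<bullet> ?v g h (\<theta> \<omega>)\<bar> \<le> \<tau>}" for g h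
  define B where "B g = B1 g \<union> (\<Union>h\<in>V-{g}. B2 g h \<union> B3 g h)" for g
  have [measurable]: "N \<in> sets M" "B1 g \<in> sets M" "B2 g h \<in> sets M" "B3 g h \<in> sets M" for g h
    by (simp_all add: N_def B1_def B2_def B3_def)
  have Bs [measurable]: "B g \<in> sets M" for g
    unfolding B_def using \<open>finite V\<close> by (intro sets.Un sets.finite_UN) auto
  define S where "S = space M - (N \<union> (\<Union>g\<in>V. B g))"
  have bad: "N \<union> (\<Union>g\<in>V. B g) \<in> sets M"
    using \<open>finite V\<close> by (intro sets.Un sets.finite_UN) auto
  have b1: "prob (B1 g) \<le> ?s" if "g \<in> V" for g
  proof -
    from t[OF that] have "g \<noteq> 0" by auto
    then show ?thesis
      unfolding B1_def using \<open>\<tau> > 0\<close>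
      by (intro std_gaussian_random_direction_small_ball[OF \<mu> indep_var_swap[OF indep]])
         (auto simp: norm_sgn)
  qed
  have b2: "prob (B2 g h) \<le> ?s" for g h
    unfolding B2_def using \<open>\<tau> > 0\<close>
    by (intro std_gaussian_random_direction_small_ball[OF \<theta> indep]) (auto simp: norm_orthogonal_direction)
  have b3: "prob (B3 g h) \<le> ?s" for g h
    unfolding B3_def using \<open>\<tau> > 0\<close>
    by (intro std_gaussian_random_direction_small_ball[OF \<mu> indep_var_swap[OF indep]])
       (auto simp: norm_orthogonal_direction)
  have b: "prob (B g) \<le> ?s + (?m - 1) * (2 * ?s)" if g: "g \<in> V" for g
  proof -
    have "prob (B g) \<le> prob (B1 g) + prob (\<Union>h\<in>V-{g}. B2 g h \<union> B3 g h)"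
      unfolding B_def using \<open>finite V\<close> by (intro measure_Un_le sets.finite_UN) auto
    also have "prob (\<Union>h\<in>V-{g}. B2 g h \<union> B3 g h) \<le> (\<Sum>h\<in>V-{g}. prob (B2 g h \<union> B3 g h))"
      using \<open>finite V\<close> by (intro finite_measure_subadditive_finite) auto
    also have "\<dots> \<le> (\<Sum>h\<in>V-{g}. 2 * ?s)"
    proof (rule sum_mono)
      fix h
      have "prob (B2 g h \<union> B3 g h) \<le> prob (B2 g h) + prob (B3 g h)"
        by (intro measure_Un_le) auto
      then show "prob (B2 g h \<union> B3 g h) \<le> 2 * ?s"
        using b2[of g h] b3[of g h] by linarith
    qed
    also have "\<dots> = (?m - 1) * (2 * ?s)"
      using g \<open>finite V\<close> card_gt_0_iff[of V] by (auto simp: card_Diff_singleton of_nat_diff)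
    finally show ?thesis using b1[OF g] by linarith
  qed
  have "prob (N \<union> (\<Union>g\<in>V. B g)) \<le> prob N + prob (\<Union>g\<in>V. B g)"
    using \<open>finite V\<close> by (intro measure_Un_le sets.finite_UN) auto
  also have "prob N \<le> 2 * real CARD('d) / c\<^sup>2"
    unfolding N_def using \<open>c > 0\<close> by (intro std_gaussian_norm_tail[OF \<theta> \<mu>]) auto
  also have "prob (\<Union>g\<in>V. B g) \<le> (\<Sum>g\<in>V. prob (B g))"
    using \<open>finite V\<close> by (intro finite_measure_subadditive_finite) auto
  also have "\<dots> \<le> (\<Sum>g\<in>V. ?s + (?m - 1) * (2 * ?s))"
    by (intro sum_mono b)
  also have "\<dots> = (?m + 2 * (?m * (?m - 1))) * ?s"
    by (simp add: algebra_simps)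
  also have "\<dots> \<le> ?m ^ 3 * ?s"
    using \<open>\<tau> > 0\<close> by (intro mult_right_mono two_square_minus_self_le_cube) auto
  finally have le: "prob (N \<union> (\<Union>g\<in>V. B g)) \<le> 2 * real CARD('d) / c\<^sup>2 + ?m ^ 3 * ?s"
    by simp
  show ?thesis
  proof (intro bexI[of _ S] conjI ballI)
    show "S \<in> sets M" using bad by (auto simp: S_def)
    show "prob S \<ge> 1 - (2 * real CARD('d) / c\<^sup>2 + ?m ^ 3 * ?s)"
      using le prob_compl[OF bad] by (simp add: S_def)
    fix \<omega> assume "\<omega> \<in> S"
    then show "well_conditioned V (\<theta> \<omega>) (\<mu> \<omega>) (sqrt 2 * c / \<tau>)"
      using \<open>\<tau> > 0\<close> \<open>c > 0\<close>
      by (intro well_conditionedI[OF t])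
         (auto simp: S_def N_def B_def B1_def B2_def B3_def not_le)
  qed
qed

end

text \<open>The numerical comparison at the end of the proof. The hypothesis \<open>sqrt (10 / pi) * y \<le> 1\<close> gives
  \<open>sqrt y \<le> 3/4\<close>, and the claim reduces to \<open>1/2 + 3 / (2 * sqrt pi) \<le> sqrt (10 / pi)\<close>.\<close>

lemma pi_power_bound: "1 / 2 * y + sqrt (2 / pi) * (sqrt 2 * sqrt y * y) \<le> sqrt (10 / pi) * y"
  if y: "0 < y" "sqrt (10 / pi) * y \<le> 1" for y :: real
proof -
  have "pi > 0" by simp
  have "y \<le> sqrt (pi / 10)"
    using y \<open>pi > 0\<close> by (simp add: real_sqrt_divide field_simps)
  also have "\<dots> \<le> sqrt ((9/16)\<^sup>2)"
    using pi_approx by (intro real_sqrt_le_mono) (simp add: power2_eq_square)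
  finally have "y \<le> (3/4)\<^sup>2" unfolding real_sqrt_abs by (simp add: power2_eq_square)
  then have sy: "sqrt y \<le> 3/4" 
    by (intro real_le_lsqrt) (use y in auto)
  have p: "1 / 2 + 2 * (3/4) / sqrt pi \<le> sqrt (10 / pi)"
  proof -
    have s: "sqrt pi \<le> 9/5" using pi_approx by (intro real_le_lsqrt) (auto simp: power2_eq_square)
    have t: "3 \<le> sqrt 10" by (intro real_le_rsqrt) auto
    have "sqrt pi > 0" by simp
    then have "1 / 2 + 2 * (3/4) / sqrt pi = (sqrt pi / 2 + 3/2) / sqrt pi" by (simp add: field_simps)
    also have "\<dots> \<le> sqrt 10 / sqrt pi"
      using s t by (intro divide_right_mono) auto
    finally show ?thesis by (simp add: real_sqrt_divide)
  qed
  have "sqrt (2 / pi) * (sqrt 2 * sqrt y * y) = 2 * sqrt y / sqrt pi * y"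
    by (simp add: real_sqrt_divide)
  also have "\<dots> \<le> 2 * (3/4) / sqrt pi * y"
    using sy y by (intro mult_right_mono divide_right_mono mult_left_mono) auto
  finally have "1 / 2 * y + sqrt (2 / pi) * (sqrt 2 * sqrt y * y) \<le> (1 / 2 + 2 * (3/4) / sqrt pi) * y"
    by (simp add: algebra_simps)
  also have "\<dots> \<le> sqrt (10 / pi) * y"
    using p y by (intro mult_right_mono) auto
  finally show ?thesis .
qed

theorem theorem14:
  fixes A E :: "'d::finite \<Rightarrow> real^'n^'n"
    and m :: nat
    and P :: "'w measure"
    and \<theta> \<mu> :: "'w \<Rightarrow> real^'d"
    and R :: real
  assumes d: "CARD('d) \<ge> 2"
    and A_sym: "\<And>k. transpose (A k) = A k"
    and A_SDC: "SDC A"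
    and A_regular: "regular_family A"
    and m: "num_eigenvalue_vectors A m"
    and E: "(\<Sum>k\<in>UNIV. (frob_norm (E k))\<^sup>2) = 1"
    and P: "prob_space P"
    and \<theta>: "distributed P lborel \<theta> std_gaussian_density"
    and \<mu>: "distributed P lborel \<mu> std_gaussian_density"
    and indep: "prob_space.indep_var P borel \<theta> borel \<mu>"
    and R: "R > 0"
  shows "\<exists>S \<in> sets P.
           (\<forall>\<omega>\<in>S. first_order_bound A E (R\<^sup>2 + 1) (\<theta> \<omega>) (\<mu> \<omega>)) \<and>
           measure P S \<ge> 1 - sqrt (10 / pi) * (real m powr (3/2) * real CARD('d) powr (3/4) / R)"
proof -
  interpret prob_space P by (rule P)
  obtain \<Lambda> :: "'n \<Rightarrow> real^'d" and \<delta> X0 t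
    where m_card: "m = card (range \<Lambda>)" and t: "\<And>l. t \<bullet> \<Lambda> l = 1"
      and \<delta>: "\<And>l. \<delta> l \<noteq> 0" and X0: "invertible X0"
      and diag: "\<And>k i j. congr X0 (A k) $ i $ j = (if i = j then \<delta> i * \<Lambda> i $ k else 0)"
    using eigenvalue_vectors_decomposition[OF m] by metis
  define n where "n = real CARD('d)"
  define y where "y = real m powr (3/2) * n powr (3/4) / R"
  have "m > 0" unfolding m_card by (simp add: card_gt_0_iff)
  have "n \<ge> 2" using d by (simp add: n_def)
  have "y > 0"
    unfolding y_def using \<open>m > 0\<close> \<open>n \<ge> 2\<close> R by simp
  show ?thesis
  proof (cases "sqrt (10 / pi) * y \<le> 1")
    case False
    \<comment> \<open>The claimed lower bound is negative.\<close>
    then show ?thesis by (intro bexI[of _ "{}"]) (auto simp: y_def n_def)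
  next
    case True
    \<comment> \<open>The threshold \<open>c\<close> for the norms balances the two failure probabilities: the norm tail becomes \<open>y / 2\<close>, and the small inner products contribute a multiple of \<open>y * sqrt y\<close>, which is small compared with \<open>y\<close>. Then \<open>\<tau>\<close> is chosen to make the projection bound equal to \<open>R\<^sup>2\<close>.\<close>
    define c where "c = 2 * sqrt n / sqrt y"
    define \<tau> where "\<tau> = sqrt 2 * c / R\<^sup>2"
    have "c > 0" using \<open>y > 0\<close> \<open>n \<ge> 2\<close> by (simp add: c_def)
    then have "\<tau> > 0" using R by (simp add: \<tau>_def)
    have r: "sqrt 2 * c / \<tau> = R\<^sup>2"
      using \<open>c > 0\<close> R by (simp add: \<tau>_def)
    obtain S where S: "S \<in> sets P"
      and wc: "\<And>\<omega>. \<omega> \<in> S \<Longrightarrow> well_conditioned (range \<Lambda>) (\<theta> \<omega>) (\<mu> \<omega>) (R\<^sup>2)"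
      and prob: "prob S \<ge> 1 - (2 * n / c\<^sup>2 + real m ^ 3 * (sqrt (2 / pi) * \<tau>))"
      using std_gaussian_well_conditioned[OF \<theta> \<mu> indep _ _ \<open>\<tau> > 0\<close> \<open>c > 0\<close>, of "range \<Lambda>" t] t
      unfolding r m_card n_def by auto
    have c2: "2 * n / c\<^sup>2 = 1 / 2 * y"
      using \<open>y > 0\<close> \<open>n \<ge> 2\<close> by (simp add: c_def power_divide power_mult_distrib)
    have y2: "real m ^ 3 / R\<^sup>2 * (n * sqrt n) = y\<^sup>2"
    proof -
      have "(real m powr (3/2))\<^sup>2 = real m ^ 3"
        using \<open>m > 0\<close> by (simp add: power2_eq_square flip: powr_add powr_numeral)
      moreover have "(n powr (3/4))\<^sup>2 = n powr (1 + 1/2)"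
        by (simp add: power2_eq_square flip: powr_add)
      then have "(n powr (3/4))\<^sup>2 = n * sqrt n"
        using \<open>n \<ge> 2\<close> unfolding powr_add by (simp add: powr_half_sqrt)
      ultimately show ?thesis
        by (simp add: y_def power_divide power_mult_distrib)
    qed
    have "real m ^ 3 * \<tau> = sqrt 2 * (2 / n) * (real m ^ 3 / R\<^sup>2 * (n * sqrt n)) / sqrt y"
      using \<open>n \<ge> 2\<close> \<open>y > 0\<close> by (simp add: \<tau>_def c_def mult_ac)
    also have "\<dots> = sqrt 2 * (2 / n) * (y\<^sup>2 / sqrt y)"
      unfolding y2 by simp
    also have "y\<^sup>2 / sqrt y = y * (y / sqrt y)"
      by (simp add: power2_eq_square)
    also have "\<dots> = sqrt y * y"
      using \<open>y > 0\<close> by (simp add: real_div_sqrt)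
    also have "sqrt 2 * (2 / n) * (sqrt y * y) \<le> sqrt 2 * 1 * (sqrt y * y)"
      using \<open>n \<ge> 2\<close> \<open>y > 0\<close> by (intro mult_right_mono mult_left_mono) auto
    finally have "real m ^ 3 * (sqrt (2 / pi) * \<tau>) \<le> sqrt (2 / pi) * (sqrt 2 * sqrt y * y)"
      using mult_left_mono[of "real m ^ 3 * \<tau>" "sqrt 2 * sqrt y * y" "sqrt (2 / pi)"]
      by (simp add: mult_ac)
    then have "2 * n / c\<^sup>2 + real m ^ 3 * (sqrt (2 / pi) * \<tau>) \<le> sqrt (10 / pi) * y"
      using pi_power_bound[OF \<open>y > 0\<close> True] unfolding c2 by linarith
    with prob have "prob S \<ge> 1 - sqrt (10 / pi) * y" by linarith
    moreover have "first_order_bound A E (R\<^sup>2 + 1) (\<theta> \<omega>) (\<mu> \<omega>)" if "\<omega> \<in> S" for \<omega>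
      by (rule first_order_bound_well_conditioned[OF \<delta> X0 diag E wc[OF that]]) simp
    ultimately show ?thesis
      using S unfolding y_def n_def by blast
  qed
qed

end
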